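(* Assume the elliptic setting described in the context (a labeled $n$-gon $P$, a return relation $T^m(P)=\Sigma_s(G(P))$, and the spectral and nondegeneracy hypotheses (i)–(iii) there, with the associated $X_1,\lambda_j,\rho,\tau,\vartheta,\xi_{r,i},w_{r,i},B_r,C_0,A_0,\widetilde p_{q,r,i}$). Suppose that, in the chosen affine chart, the projectivity $G$ is written as $$f(x)=\frac{Ax+b}{c^\top x+d},$$ where $A$ is a real $2\times2$ matrix, $b,c\in\mathbb{R}^2$, $d\in\mathbb{R}$, and let $X_1$ be the finite attracting fixed point corresponding to the dominant real eigenvalue. Then $$M=\mathrm Df_{X_1}=\frac{A-X_1c^\top}{c^\top X_1+d}$$ has eigenvalues $\tau e^{\pm\mathrm i\vartheta}$, where $\tau=\rho/|\lambda_1|$. There is a positive definite symmetric matrix $H$, unique up to multiplication by a positive scalar, such that $$M^\top HM=\tau^2H.$$ Define $$s_{r,i}=\frac{A_0}{B_r}\,w_{r,i}^\top Hw_{r,i}.$$ Then the asymptotic ellipse followed by the $i$-th vertex in the $r$-th residue class is $$(y-C_0)^\top H(y-C_0)=s_{r,i},$$ i.e. $(\widetilde p_{q,r,i}-C_0)^\top H(\widetilde p_{q,r,i}-C_0)\to s_{r,i}$ as $q\to\infty$. Replacing $H$ by a positive multiple multiplies every $s_{r,i}$ by the same factor and leaves the ellipses unchanged. Consequently, all these ellipses are concentric and homothetic; their common principal directions (unless they are circles) and their common axis ratio are determined by $G$ alone, whereas their levels $s_{r,i}$ may depend on the residue class $r$ and the vertex $i$. Equivalently, the area-normalized orbit is organized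 into $m$ indexed elliptic families, one for each residue class modulo $m$. If $s\ne0$, the vertex index $i$ refers to the relabelled subsequence $\widetilde P_{q,r}=\Sigma_{-qs}(\widehat T^{qm+r}(P))$; without undoing this cyclic relabelling, the same conclusion holds setwise.
   Context: Labeled polygons: $P=(p_1,\dots,p_n)$ with $p_i\in\mathbb{R}^2$, indices modulo $n$; $\mathbb{R}^2\subset\mathbb{RP}^2$ via $x\mapsto[x:1]$. The pentagram map is $T(P)_i=(p_ip_{i+2})\cap(p_{i+1}p_{i+3})$, defined when, for every $i$, these two lines are well defined and not parallel. Put $C(P)=\frac1n\sum_i p_i$ and $\operatorname{Area}(P)=\bigl|\frac12\sum_i\det(p_i,p_{i+1})\bigr|$. The area-normalized pentagram map is $\widehat T(P)_i=C(P)+\sqrt{\operatorname{Area}(P)/\operatorname{Area}(T(P))}\,(T(P)_i-C(T(P)))$. Cyclic relabelling: $\Sigma_s(P)_i=p_{i+s}$. A projectivity is a projective transformation of $\mathbb{RP}^2$ given by a real invertible $3\times3$ matrix, acting on polygons vertexwise. Elliptic setting. (i) There are an integer $m\ge1$, a real projectivity $G$, and a shift $\Sigma_s$ ($s=0$ allowed) with $T^m(P)=\Sigma_s(G(P))$; all forward pentagram iterates of $P$ are defined and have nonzero unsigned area. (ii) A real matrix $\widetilde G\in\mathrm{GL}(3,\mathbb{R})$ representing $G$ has one simple real eigenvalue $\lambda_1$ and a non-real conjugate pair $\lambda_{2,3}=\rho e^{\pm\mathrm i\theta}$, $\rho>0$, $0<\theta<\pi$, with $|\lambda_1|>\rho$.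 With $v_1$ a real eigenvector for $\lambda_1$, the point $X_1=[v_1]$ lies in the affine chart $\mathbb{R}^2$. $f$ is the affine expression of $G$ near $X_1$; $\tau=\rho/|\lambda_1|<1$; $\vartheta$ satisfies $\lambda_2/\lambda_1=\tau e^{\mathrm i\vartheta}$. (iii) For $r=0,\dots,m-1$ let $Q_r=T^r(P)=(q_{r,1},\dots,q_{r,n})$. For every homogeneous lift of every $q_{r,i}$, the spectral projection onto $\mathbb{R}v_1$ along the real invariant plane associated with $\lambda_2,\lambda_3$ is nonzero. With $M=\mathrm Df_{X_1}$ and $R=\tau^{-1}M$, define $\xi_{r,i}\in\mathbb{R}^2$ by $f^q(q_{r,i})=X_1+\tau^qR^q\xi_{r,i}+O(\tau^{2q})$ as $q\to\infty$ (where $f^q(q_{r,i})$ denotes the affine point $G^q(q_{r,i})$), and put $w_{r,i}=\xi_{r,i}-\frac1n\sum_j\xi_{r,j}$, $B_r=\bigl|\frac12\sum_i\det(w_{r,i},w_{r,i+1})\bigr|$. Assume $w_{r,i}\ne0$ for every $i$ and $B_r>0$. Notation: $C_0=C(P)$, $A_0=\operatorname{Area}(P)$, $\widetilde P_{q,r}=\Sigma_{-qs}(\widehat T^{qm+r}(P))=(\widetilde p_{q,r,1},\dots,\widetilde p_{q,r,n})$. *)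

theory Defs
  imports "HOL-Analysis.Analysis" "HOL-Library.Landau_Symbols"
begin

text \<open>A labeled \<open>n\<close>-gon is an \<open>n\<close>-periodic map on the integers, which is the same as a vertex
  family with indices modulo \<open>n\<close>.\<close>

definition ngon :: "nat \<Rightarrow> (int \<Rightarrow> 'a) \<Rightarrow> bool" where
  "ngon n P \<longleftrightarrow> 1 \<le> n \<and> (\<forall>i. P (i + int n) = P i)"

definition relabel :: "int \<Rightarrow> (int \<Rightarrow> 'a) \<Rightarrow> (int \<Rightarrow> 'a)" where
  "relabel s P = (\<lambda>i. P (i + s))"

definition centroid :: "nat \<Rightarrow> (int \<Rightarrow> real^2) \<Rightarrow> real^2" where
  "centroid n P = (1 / real n) *\<^sub>R (\<Sum>i\<in>{1..int n}. P i)"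

definition area :: "nat \<Rightarrow> (int \<Rightarrow> real^2) \<Rightarrow> real" where
  "area n P = \<bar>(1/2) * (\<Sum>i\<in>{1..int n}. det (vector [P i, P (i + 1)] :: real^2^2))\<bar>"

definition line :: "real^2 \<Rightarrow> real^2 \<Rightarrow> (real^2) set" where
  "line a b = affine hull {a, b}"

definition pentagram_defined :: "(int \<Rightarrow> real^2) \<Rightarrow> bool" where
  "pentagram_defined P \<longleftrightarrow>
     (\<forall>i. P i \<noteq> P (i + 2) \<and> P (i + 1) \<noteq> P (i + 3) \<and>
          \<not> affine_parallel (line (P i) (P (i + 2))) (line (P (i + 1)) (P (i + 3))))"

definition pentagram :: "(int \<Rightarrow> real^2) \<Rightarrow> (int \<Rightarrow> real^2)" where
  "pentagram P = (\<lambda>i. THE x. x \<in> line (P i) (P (i + 2)) \<inter> line (P (i + 1)) (P (i + 3)))"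

definition normalized_pentagram :: "nat \<Rightarrow> (int \<Rightarrow> real^2) \<Rightarrow> (int \<Rightarrow> real^2)" where
  "normalized_pentagram n P =
     (\<lambda>i. centroid n P +
        sqrt (area n P / area n (pentagram P)) *\<^sub>R (pentagram P i - centroid n (pentagram P)))"

typedef rp2 = "{L :: (real^3) set. \<exists>v. v \<noteq> 0 \<and> L = span {v}}"
  morphisms line_of Abs_rp2
proof -
  have "(axis 1 1 :: real^3) \<noteq> 0" by (simp add: axis_eq_0_iff)
  then show ?thesis by blast
qed

text \<open>\<open>hpoint v\<close> is the point \<open>[v]\<close>; it is meaningful for \<open>v \<noteq> 0\<close> only.\<close>

definition hpoint :: "real^3 \<Rightarrow> rp2" where
  "hpoint v = Abs_rp2 (span {v})"

definition chart_embed :: "real^2 \<Rightarrow> rp2" where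
  "chart_embed x = hpoint (vector [x $ 1, x $ 2, 1])"

text \<open>Meaningful for invertible matrices only.\<close>

definition projectivity :: "real^3^3 \<Rightarrow> rp2 \<Rightarrow> rp2" where
  "projectivity N L = Abs_rp2 ((\<lambda>v. N *v v) ` line_of L)"

text \<open>\<open>affine_point\<close> is the inverse of \<open>chart_embed\<close> on the affine chart \<open>range chart_embed\<close>, so
  \<open>affine_map G\<close> is the partially defined expression of \<open>G\<close> in that chart.\<close>

definition affine_point :: "rp2 \<Rightarrow> real^2" where
  "affine_point p = (THE x. chart_embed x = p)"

definition affine_map :: "(rp2 \<Rightarrow> rp2) \<Rightarrow> real^2 \<Rightarrow> real^2" where
  "affine_map G x = affine_point (G (chart_embed x))"

definition linearization :: "(rp2 \<Rightarrow> rp2) \<Rightarrow> real^2 \<Rightarrow> real^2^2" where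
  "linearization G X = jacobian (affine_map G) (at X)"

definition cvec :: "real^'n \<Rightarrow> complex^'n" where
  "cvec v = (\<chi> i. complex_of_real (v $ i))"

definition cmat :: "real^'n^'m \<Rightarrow> complex^'n^'m" where
  "cmat N = (\<chi> i j. complex_of_real (N $ i $ j))"

definition eigenvalues :: "real^'n^'n \<Rightarrow> complex set" where
  "eigenvalues N = {z. \<exists>u. u \<noteq> 0 \<and> cmat N *v u = z *s u}"

text \<open>The real vectors in the sum of the complex eigenspaces for \<open>z\<close> and \<open>cnj z\<close>.\<close>

definition real_invariant_space :: "real^'n^'n \<Rightarrow> complex \<Rightarrow> (real^'n) set" where
  "real_invariant_space N z =
     {x. \<exists>u w. cmat N *v u = z *s u \<and> cmat N *v w = cnj z *s w \<and> cvec x = u + w}"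

text \<open>The projection onto \<open>span {v}\<close> along a complementary subspace \<open>W\<close>.\<close>

definition projection_along :: "'a::real_vector \<Rightarrow> 'a set \<Rightarrow> 'a \<Rightarrow> 'a" where
  "projection_along v W h = (THE y. y \<in> span {v} \<and> h - y \<in> W)"

definition sym_posdef :: "real^'n^'n \<Rightarrow> bool" where
  "sym_posdef H \<longleftrightarrow> transpose H = H \<and> (\<forall>x. x \<noteq> 0 \<longrightarrow> 0 < x \<bullet> (H *v x))"

text \<open>The vector \<open>\<xi>\<close> with \<open>f\<^sup>q(x) = X + \<tau>\<^sup>q R\<^sup>q \<xi> + O(\<tau>\<^sup>2\<^sup>q)\<close>, where \<open>f\<^sup>q(x)\<close> is the affine point of
  \<open>G\<^sup>q(x)\<close>, \<open>R = M/\<tau>\<close> and \<open>M\<close> is the linearization of \<open>G\<close> at \<open>X\<close>.\<close>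

definition leading_coeff :: "(rp2 \<Rightarrow> rp2) \<Rightarrow> real^2 \<Rightarrow> real \<Rightarrow> real^2 \<Rightarrow> real^2" where
  "leading_coeff G X \<tau> x =
     (let R = (1 / \<tau>) *\<^sub>R linearization G X
      in THE \<xi>. (\<lambda>q. norm (affine_point ((G ^^ q) (chart_embed x))
                            - (X + \<tau> ^ q *\<^sub>R ((\<lambda>v. R *v v) ^^ q) \<xi>)))
                  \<in> O(\<lambda>q. \<tau> ^ (2 * q)))"

text \<open>\<open>limit_shape n G X \<tau> P r\<close> is the polygon with vertices \<open>w\<^sub>r\<^sub>,\<^sub>i\<close>; its area is \<open>B\<^sub>r\<close>.\<close>

definition limit_shape ::
  "nat \<Rightarrow> (rp2 \<Rightarrow> rp2) \<Rightarrow> real^2 \<Rightarrow> real \<Rightarrow> (int \<Rightarrow> real^2) \<Rightarrow> nat \<Rightarrow> int \<Rightarrow> real^2" where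
  "limit_shape n G X \<tau> P r =
     (let \<xi> = (\<lambda>i. leading_coeff G X \<tau> ((pentagram ^^ r) P i))
      in (\<lambda>i. \<xi> i - centroid n \<xi>))"

definition return_relation ::
  "nat \<Rightarrow> (int \<Rightarrow> real^2) \<Rightarrow> nat \<Rightarrow> int \<Rightarrow> (rp2 \<Rightarrow> rp2) \<Rightarrow> bool" where
  "return_relation n P m s G \<longleftrightarrow>
     ngon n P \<and> 1 \<le> m \<and>
     (\<forall>k. pentagram_defined ((pentagram ^^ k) P) \<and> area n ((pentagram ^^ k) P) \<noteq> 0) \<and>
     (\<lambda>i. chart_embed ((pentagram ^^ m) P i)) = relabel s (\<lambda>i. G (chart_embed (P i)))"

text \<open>The three listed eigenvalues are pairwise distinct since \<open>0 < \<theta> < \<pi>\<close>, so all of them,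
  in particular \<open>lam\<^sub>1\<close>, are simple.\<close>

definition elliptic_spectrum ::
  "(rp2 \<Rightarrow> rp2) \<Rightarrow> real^3^3 \<Rightarrow> real \<Rightarrow> real \<Rightarrow> real \<Rightarrow> real^3 \<Rightarrow> real^2 \<Rightarrow> real \<Rightarrow> real \<Rightarrow> bool" where
  "elliptic_spectrum G N lam\<^sub>1 \<rho> \<theta> v\<^sub>1 X\<^sub>1 \<tau> \<phi> \<longleftrightarrow>
     invertible N \<and> G = projectivity N \<and>
     eigenvalues N = {complex_of_real lam\<^sub>1, \<rho> * cis \<theta>, \<rho> * cis (- \<theta>)} \<and>
     0 < \<rho> \<and> 0 < \<theta> \<and> \<theta> < pi \<and> \<rho> < \<bar>lam\<^sub>1\<bar> \<and>
     v\<^sub>1 \<noteq> 0 \<and> N *v v\<^sub>1 = lam\<^sub>1 *\<^sub>R v\<^sub>1 \<and> chart_embed X\<^sub>1 = hpoint v\<^sub>1 \<and>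
     \<tau> = \<rho> / \<bar>lam\<^sub>1\<bar> \<and> \<rho> * cis \<theta> / lam\<^sub>1 = \<tau> * cis \<phi>"

definition nondegenerate_orbit ::
  "nat \<Rightarrow> (int \<Rightarrow> real^2) \<Rightarrow> nat \<Rightarrow> (rp2 \<Rightarrow> rp2) \<Rightarrow> real^3^3 \<Rightarrow> real \<Rightarrow> real \<Rightarrow> real^3 \<Rightarrow> real^2 \<Rightarrow> real
     \<Rightarrow> bool" where
  "nondegenerate_orbit n P m G N \<rho> \<theta> v\<^sub>1 X\<^sub>1 \<tau> \<longleftrightarrow>
     (\<forall>r<m. \<forall>i h. h \<noteq> 0 \<and> hpoint h = chart_embed ((pentagram ^^ r) P i) \<longrightarrow>
        projection_along v\<^sub>1 (real_invariant_space N (\<rho> * cis \<theta>)) h \<noteq> 0) \<and>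
     (\<forall>r<m. \<forall>i. limit_shape n G X\<^sub>1 \<tau> P r i \<noteq> 0) \<and>
     (\<forall>r<m. 0 < area n (limit_shape n G X\<^sub>1 \<tau> P r))"

definition elliptic_setting ::
  "nat \<Rightarrow> (int \<Rightarrow> real^2) \<Rightarrow> nat \<Rightarrow> int \<Rightarrow> (rp2 \<Rightarrow> rp2) \<Rightarrow> real^3^3 \<Rightarrow> real \<Rightarrow> real \<Rightarrow> real \<Rightarrow> real^3 \<Rightarrow> real^2
     \<Rightarrow> real \<Rightarrow> real \<Rightarrow> bool" where
  "elliptic_setting n P m s G N lam\<^sub>1 \<rho> \<theta> v\<^sub>1 X\<^sub>1 \<tau> \<phi> \<longleftrightarrow>
     return_relation n P m s G \<and>
     elliptic_spectrum G N lam\<^sub>1 \<rho> \<theta> v\<^sub>1 X\<^sub>1 \<tau> \<phi> \<and>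
     nondegenerate_orbit n P m G N \<rho> \<theta> v\<^sub>1 X\<^sub>1 \<tau>"

definition level ::
  "nat \<Rightarrow> (rp2 \<Rightarrow> rp2) \<Rightarrow> real^2 \<Rightarrow> real \<Rightarrow> (int \<Rightarrow> real^2) \<Rightarrow> real^2^2 \<Rightarrow> nat \<Rightarrow> int \<Rightarrow> real" where
  "level n G X \<tau> P H r i =
     (let w = limit_shape n G X \<tau> P r in area n P / area n w * (w i \<bullet> (H *v w i)))"

definition ellipse :: "real^2 \<Rightarrow> real^2^2 \<Rightarrow> real \<Rightarrow> (real^2) set" where
  "ellipse C H t = {y. (y - C) \<bullet> (H *v (y - C)) = t}"

definition homothetic_about :: "real^2 \<Rightarrow> (real^2) set \<Rightarrow> (real^2) set \<Rightarrow> bool" where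
  "homothetic_about C E E' \<longleftrightarrow> (\<exists>k>0. E' = (\<lambda>y. C + k *\<^sub>R (y - C)) ` E)"

text \<open>The directions of the major and minor axes of an ellipse \<open>E\<close> with centre \<open>C\<close>: those in which
  the distance from \<open>C\<close> to \<open>E\<close> is maximal or minimal. For a circle all directions qualify.\<close>

definition principal_directions :: "real^2 \<Rightarrow> (real^2) set \<Rightarrow> (real^2) set" where
  "principal_directions C E =
     {u. u \<noteq> 0 \<and> (\<exists>y\<in>E. y - C \<in> span {u} \<and>
           ((\<forall>z\<in>E. dist C z \<le> dist C y) \<or> (\<forall>z\<in>E. dist C y \<le> dist C z)))}"

definition axis_ratio :: "real^2 \<Rightarrow> (real^2) set \<Rightarrow> real" where
  "axis_ratio C E = (SUP y\<in>E. dist C y) / (INF y\<in>E. dist C y)"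

text \<open>Convergence of a sequence of sets to a fixed set in the Hausdorff distance.\<close>

definition setwise_tendsto :: "(nat \<Rightarrow> 'a::metric_space set) \<Rightarrow> 'a set \<Rightarrow> bool" where
  "setwise_tendsto V S \<longleftrightarrow>
     (\<forall>\<epsilon>>0. \<forall>\<^sub>F q in sequentially.
        (\<forall>x\<in>V q. \<exists>y\<in>S. dist x y < \<epsilon>) \<and> (\<forall>y\<in>S. \<exists>x\<in>V q. dist x y < \<epsilon>))"

end

theory Submission
  imports Defs
begin

text \<open>
  Let \<open>l\<close> be the left eigenvector of \<open>N\<close> for \<open>lam\<^sub>1\<close>, normalized to take the value 1 at the lift of
  \<open>X\<^sub>1\<close>. Modulo this lift, \<open>N / lam\<^sub>1\<close> acts on \<open>\<real>\<^sup>3\<close> as \<open>M\<close>, so that \<open>f\<^sup>q(x) = X\<^sub>1 + M\<^sup>q (x - X\<^sub>1) / t\<^sub>q\<close>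
  holds exactly, where the last homogeneous coordinate \<open>t\<^sub>q\<close> of \<open>(N / lam\<^sub>1)\<^sup>q\<close> at the lift of \<open>x\<close> converges
  to \<open>l(x) \<noteq> 0\<close>; hence \<open>\<xi> = (x - X\<^sub>1) / l(x)\<close>. The pentagram map commutes with projectivities, and its
  normalization with homotheties, so up to homothety the normalized polygon is \<open>M\<^sup>q\<close> applied to a
  convergent sequence of polygons. The factor \<open>\<tau>\<^sup>2\<^sup>q = det M\<^sup>q\<close> by which \<open>M\<^sup>q\<close> scales the invariant form is
  also the factor by which it scales areas, and the two cancel after normalization.
\<close>

subsection \<open>Invariant forms of planar linear maps\<close>

text \<open>The covector \<open>l\<close> exists because 1 is not an eigenvalue of \<open>M\<close>:
  its coefficients solve a linear system with matrix \<open>1 - M\<close>, whose determinant 1 - tr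
  M + det M is positive as soon as (tr M)^2 < 4 det M. The same inequality produces the invariant
  form, and this form replaces any diagonalization. Since \<open>M\<close> scales it by exactly
  \<tau>^2, it bounds \<open>M\<^sup>q p\<close> by a multiple of \<open>\<tau>\<^sup>q\<close>, and
  it also keeps \<open>M\<^sup>q p\<close> from being \<open>O(\<tau>\<^sup>2\<^sup>q)\<close>
  unless \<open>p = 0\<close>. The first estimate gives the error term in the expansion of
  \<open>f\<^sup>q\<close>, the second the uniqueness of \<xi>, which is given by a definite
  description. The exact formula for \<open>f\<^sup>q(x)\<close> needs \<open>t\<^sub>q\<close>
  nonzero. For vertices of the orbit this holds at every \<open>q\<close>, because the iterated
  return relation identifies \<open>G\<^sup>q(x)\<close> with a vertex of a pentagram iterate, hence
  with a chart point. That \<open>l(x)\<close> is nonzero is the spectral projection hypothesis,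
  once the real invariant plane is recognized as the kernel of \<open>l\<close>.\<close>

lemma mem_eigenvalues_2:
  fixes M :: "real^2^2"
  shows "z \<in> eigenvalues M \<longleftrightarrow> z\<^sup>2 - of_real (trace M) * z + of_real (det M) = 0"
proof -
  define a b c d where "a = complex_of_real (M$1$1)" and "b = complex_of_real (M$1$2)"
    and "c = complex_of_real (M$2$1)" and "d = complex_of_real (M$2$2)"
  have ev: "z \<in> eigenvalues M \<longleftrightarrow> (\<exists>x y. (x \<noteq> 0 \<or> y \<noteq> 0) \<and> a * x + b * y = z * x \<and> c * x + d * y = z * y)"
    (is "_ \<longleftrightarrow> ?R")
  proof
    assume "z \<in> eigenvalues M"
    then obtain u where "u \<noteq> 0" "cmat M *v u = z *s u"
      by (auto simp: eigenvalues_def)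
    then show ?R
      by (intro exI[of _ "u$1"] exI[of _ "u$2"])
        (auto simp: vec_eq_iff forall_2 matrix_vector_mult_def sum_2 cmat_def a_def b_def c_def d_def)
  next
    assume ?R
    then obtain x y where "x \<noteq> 0 \<or> y \<noteq> 0" "a * x + b * y = z * x" "c * x + d * y = z * y" by blast
    then show "z \<in> eigenvalues M"
      unfolding eigenvalues_def mem_Collect_eq
      by (intro exI[of _ "vector [x, y]"])
        (auto simp: vec_eq_iff forall_2 matrix_vector_mult_def sum_2 cmat_def a_def b_def c_def d_def)
  qed
  have cp: "z\<^sup>2 - of_real (trace M) * z + of_real (det M) = (a - z) * (d - z) - b * c"
    by (simp add: trace_def sum_2 det_2 a_def b_def c_def d_def algebra_simps power2_eq_square)
  show ?thesis
    unfolding ev cp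
  proof
    assume "\<exists>x y. (x \<noteq> 0 \<or> y \<noteq> 0) \<and> a * x + b * y = z * x \<and> c * x + d * y = z * y"
    then obtain x y where xy: "x \<noteq> 0 \<or> y \<noteq> 0" "(a - z) * x + b * y = 0" "c * x + (d - z) * y = 0"
      by (auto simp: algebra_simps)
    have "((a - z) * (d - z) - b * c) * x = 0" "((a - z) * (d - z) - b * c) * y = 0"
      using xy(2,3) by algebra+
    with xy(1) show "(a - z) * (d - z) - b * c = 0" by auto
  next
    assume D: "(a - z) * (d - z) - b * c = 0"
    show "\<exists>x y. (x \<noteq> 0 \<or> y \<noteq> 0) \<and> a * x + b * y = z * x \<and> c * x + d * y = z * y"
    \<comment> \<open>A nonzero row of the singular matrix with rows (a - z, b) and (c, d - z)
      determines its kernel: the row rotated by a right angle is annihilated by both rows.\<close>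
    proof (cases "a - z = 0 \<and> b = 0")
      case True
      then show ?thesis
      proof (cases "d - z = 0 \<and> c = 0")
        case True
        then show ?thesis using \<open>a - z = 0 \<and> b = 0\<close> by (intro exI[of _ 1] exI[of _ 0]) auto
      next
        case False
        with \<open>a - z = 0 \<and> b = 0\<close> show ?thesis
          by (intro exI[of _ "z - d"] exI[of _ c]) (auto simp: algebra_simps)
      qed
    next
      case False
      with D show ?thesis
        by (intro exI[of _ "- b"] exI[of _ "a - z"]) (auto simp: algebra_simps)
    qed
  qed
qed

text \<open>The imaginary part of the characteristic equation is Im \<mu> (2 Re \<mu> - tr M), which
  yields the trace; the real part then yields the determinant, and the polynomial factors as (z -
  \<mu>)(z - cnj \<mu>).\<close>

lemma nonreal_eigenvalue_2:
  fixes M :: "real^2^2"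
  assumes "\<mu> \<in> eigenvalues M" and "Im \<mu> \<noteq> 0"
  shows "trace M = 2 * Re \<mu>" and "det M = (cmod \<mu>)\<^sup>2" and "eigenvalues M = {\<mu>, cnj \<mu>}"
proof -
  have eq: "\<mu>\<^sup>2 - of_real (trace M) * \<mu> + of_real (det M) = 0"
    using assms(1) by (simp add: mem_eigenvalues_2)
  have "Im \<mu> * (2 * Re \<mu> - trace M) = 0"
    using arg_cong[OF eq, of Im] by (simp add: power2_eq_square algebra_simps)
  with assms(2) show tr: "trace M = 2 * Re \<mu>" by simp
  show dt: "det M = (cmod \<mu>)\<^sup>2"
    using arg_cong[OF eq, of Re] unfolding cmod_power2 by (simp add: tr power2_eq_square algebra_simps)
  have "z\<^sup>2 - of_real (trace M) * z + of_real (det M) = (z - \<mu>) * (z - cnj \<mu>)" for z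
  proof -
    have "complex_of_real (trace M) = \<mu> + cnj \<mu>" "complex_of_real (det M) = \<mu> * cnj \<mu>"
      by (simp_all add: tr dt complex_add_cnj complex_mult_cnj cmod_power2)
    then show ?thesis by (simp add: algebra_simps power2_eq_square)
  qed
  then show "eigenvalues M = {\<mu>, cnj \<mu>}"
    by (auto simp: mem_eigenvalues_2)
qed

lemma nonreal_eigenvalue_discriminant:
  fixes M :: "real^2^2"
  assumes "\<mu> \<in> eigenvalues M" and "Im \<mu> \<noteq> 0"
  shows "(trace M)\<^sup>2 < 4 * det M"
  using assms nonreal_eigenvalue_2[OF assms]
  by (simp add: cmod_power2 power_mult_distrib)

text \<open>When \<open>M\<close> has no real eigenvector, \<open>x \<mapsto> det (x, M x)\<close> is a definite form that \<open>M\<close> scales by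
  \<open>det M\<close>; the matrix below is its Gram matrix with the sign that makes it positive.\<close>

lemma ex1_invariant_form:
  fixes M :: "real^2^2"
  assumes disc: "(trace M)\<^sup>2 < 4 * det M"
  shows "\<exists>H. (sym_posdef H \<and> transpose M ** H ** M = det M *\<^sub>R H) \<and>
    (\<forall>H'. sym_posdef H' \<and> transpose M ** H' ** M = det M *\<^sub>R H' \<longleftrightarrow> (\<exists>k>0. H' = k *\<^sub>R H))"
proof -
  define a b c d where abcd: "a = M$1$1" "b = M$1$2" "c = M$2$1" "d = M$2$2"
  have disc': "(d - a)\<^sup>2 + 4 * b * c < 0"
    using disc by (simp add: abcd trace_def sum_2 det_2 power2_eq_square algebra_simps)
  then have c: "c \<noteq> 0" by auto
  have det: "det M = a * d - b * c" by (simp add: det_2 abcd)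
  have det0: "a * d - b * c \<noteq> 0"
    using disc unfolding det by (smt (verit) zero_le_power2)
  \<comment> \<open>Explicitly, det (x, M x) = c x1^2 + (d - a) x1 x2 - b x2^2, and
    \<open>sgn c\<close> is the sign in question.\<close>
  define H :: "real^2^2" where
    "H = vector [vector [\<bar>c\<bar>, sgn c * (d - a) / 2], vector [sgn c * (d - a) / 2, - sgn c * b]]"
  have mat_eq: "transpose M ** K ** M = det M *\<^sub>R K \<longleftrightarrow>
      (a*(a*K$1$1 + c*K$2$1) + c*(a*K$1$2 + c*K$2$2) = (a*d-b*c)*K$1$1 \<and>
       b*(a*K$1$1 + c*K$2$1) + d*(a*K$1$2 + c*K$2$2) = (a*d-b*c)*K$1$2 \<and>
       a*(b*K$1$1 + d*K$2$1) + c*(b*K$1$2 + d*K$2$2) = (a*d-b*c)*K$2$1 \<and>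
       b*(b*K$1$1 + d*K$2$1) + d*(b*K$1$2 + d*K$2$2) = (a*d-b*c)*K$2$2)" for K :: "real^2^2"
    unfolding det abcd
    by (simp add: vec_eq_iff forall_2 matrix_matrix_mult_def transpose_def sum_2 algebra_simps)
  have invH: "transpose M ** H ** M = det M *\<^sub>R H"
    unfolding mat_eq H_def by (simp add: abs_sgn algebra_simps add_divide_distrib diff_divide_distrib)
  have quad: "x \<bullet> (K *v x) = K$1$1 * (x$1)\<^sup>2 + (K$1$2 + K$2$1) * x$1 * x$2 + K$2$2 * (x$2)\<^sup>2"
    for K :: "real^2^2" and x
    by (simp add: inner_vec_def matrix_vector_mult_def sum_2 algebra_simps power2_eq_square)
  have posH: "0 < x \<bullet> (H *v x)" if "x \<noteq> 0" for x
  proof -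
    \<comment> \<open>Completing the square in the first coordinate leaves the negative discriminant
      as the coefficient that is subtracted.\<close>
    have sq: "4 * \<bar>c\<bar> * (x \<bullet> (H *v x)) = (2 * c * x$1 + (d - a) * x$2)\<^sup>2 - ((d - a)\<^sup>2 + 4 * b * c) * (x$2)\<^sup>2"
      using c unfolding quad by (cases "c > 0") (simp_all add: H_def algebra_simps power2_eq_square)
    have "0 < 4 * \<bar>c\<bar> * (x \<bullet> (H *v x))"
    proof (cases "x$2 = 0")
      case True
      then have "x$1 \<noteq> 0" using that by (auto simp: vec_eq_iff forall_2)
      then show ?thesis unfolding sq using True c by simp
    next
      case False
      then have "0 < - ((d - a)\<^sup>2 + 4 * b * c) * (x$2)\<^sup>2"
        using disc' by (intro mult_pos_pos) auto
      then show ?thesis unfolding sq by (smt (verit) mult_minus_left zero_le_power2)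
    qed
    then show ?thesis using c by (simp add: zero_less_mult_iff)
  qed
  have symH: "transpose H = H"
    by (simp add: H_def vec_eq_iff forall_2 transpose_def)
  have "\<exists>k>0. K = k *\<^sub>R H" if K: "sym_posdef K" "transpose M ** K ** M = det M *\<^sub>R K" for K
  proof -
    have sym: "K$2$1 = K$1$2"
    proof -
      have "transpose K = K" using K(1) by (simp only: sym_posdef_def)
      then have "transpose K $ 1 $ 2 = K $ 1 $ 2" by (rule arg_cong)
      then show ?thesis by (simp add: transpose_def)
    qed
    \<comment> \<open>Both vanish exactly when \<open>K\<close> is proportional to \<open>H\<close>.
      Two of the invariance equations say that the transpose of \<open>M\<close> annihilates the
      vector (Y, X), and det M is nonzero.\<close>
    define X Y where "X = K$1$1 * b + K$2$2 * c" and "Y = 2 * K$1$2 * c - (d - a) * K$1$1"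
    have e: "a * Y + c * X = 0" "b * Y + d * X = 0"
    proof -
      have "a * Y + c * X = a*(a*K$1$1 + c*K$1$2) + c*(a*K$1$2 + c*K$2$2) - (a*d-b*c)*K$1$1"
        "b * Y + d * X = b*(a*K$1$1 + c*K$1$2) + d*(a*K$1$2 + c*K$2$2) - (a*d-b*c)*K$1$2"
        unfolding X_def Y_def by (simp_all add: algebra_simps)
      with K(2) show "a * Y + c * X = 0" "b * Y + d * X = 0" unfolding mat_eq sym by simp_all
    qed
    have "(a * d - b * c) * X = a * (b * Y + d * X) - b * (a * Y + c * X)"
      "(a * d - b * c) * Y = d * (a * Y + c * X) - c * (b * Y + d * X)" by (simp_all add: algebra_simps)
    then have "(a * d - b * c) * X = 0" "(a * d - b * c) * Y = 0" unfolding e by simp_all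
    then have X: "X = 0" and Y: "Y = 0" using det0 by auto
    have "axis 1 1 \<noteq> (0 :: real^2)" by (simp add: axis_eq_0_iff)
    then have "0 < axis 1 1 \<bullet> (K *v axis 1 1)" using K(1) unfolding sym_posdef_def by blast
    then have p: "0 < K$1$1" unfolding quad by (simp add: axis_def)
    have k12: "K$1$2 = (d - a) * K$1$1 / (2 * c)" and k22: "K$2$2 = - K$1$1 * b / c"
      using X Y c by (simp_all add: X_def Y_def field_simps)
    have "K = (K$1$1 / \<bar>c\<bar>) *\<^sub>R H"
      using c by (cases "c > 0") (simp_all add: H_def vec_eq_iff forall_2 sym k12 k22 field_simps)
    then show ?thesis using p c by (intro exI[of _ "K$1$1 / \<bar>c\<bar>"]) simp
  qed
  moreover have "sym_posdef (k *\<^sub>R H) \<and> transpose M ** (k *\<^sub>R H) ** M = det M *\<^sub>R (k *\<^sub>R H)" if "k > 0" for k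
  proof -
    have "transpose M ** (k *\<^sub>R H) ** M = k *\<^sub>R (transpose M ** H ** M)"
      by (simp add: vec_eq_iff forall_2 matrix_matrix_mult_def transpose_def sum_2 algebra_simps)
    moreover have "transpose (k *\<^sub>R H) = k *\<^sub>R transpose H"
      by (simp add: vec_eq_iff transpose_def)
    moreover have "0 < x \<bullet> ((k *\<^sub>R H) *v x)" if "x \<noteq> 0" for x
      using posH[OF that] \<open>k > 0\<close> by (simp flip: scaleR_matrix_vector_assoc)
    ultimately show ?thesis by (simp add: invH symH sym_posdef_def)
  qed
  moreover have "sym_posdef H \<and> transpose M ** H ** M = det M *\<^sub>R H"
    using symH posH invH unfolding sym_posdef_def by blast
  ultimately show ?thesis by blast
qed

subsection \<open>The pentagram map and projectivities\<close>

definition homog :: "real^2 \<Rightarrow> real^3" where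
  "homog x = vector [x$1, x$2, 1]"

definition dehomog :: "real^3 \<Rightarrow> real^2" where
  "dehomog v = (1 / v$3) *\<^sub>R vector [v$1, v$2]"

lemma chart_embed_homog: "chart_embed x = hpoint (homog x)"
  by (simp add: chart_embed_def homog_def)

lemma homog_nth [simp]: "homog x $ 1 = x$1" "homog x $ 2 = x$2" "homog x $ 3 = 1"
  by (simp_all add: homog_def)

lemma homog_nonzero [simp]: "homog x \<noteq> 0"
  by (auto simp: vec_eq_iff forall_3)

lemma dehomog_nth [simp]: "dehomog v $ 1 = v$1 / v$3" "dehomog v $ 2 = v$2 / v$3"
  by (simp_all add: dehomog_def)

lemma scaleR_homog_dehomog: "v$3 \<noteq> 0 \<Longrightarrow> v$3 *\<^sub>R homog (dehomog v) = v"
  by (simp add: vec_eq_iff forall_3)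

lemma line_of_hpoint: "v \<noteq> 0 \<Longrightarrow> line_of (hpoint v) = span {v}"
  unfolding hpoint_def by (rule Abs_rp2_inverse) blast

lemma hpoint_eq_iff:
  assumes "v \<noteq> 0" "w \<noteq> 0"
  shows "hpoint v = hpoint w \<longleftrightarrow> (\<exists>k. w = k *\<^sub>R v)"
proof -
  have "hpoint v = hpoint w \<longleftrightarrow> span {v} = span {w}"
    using assms by (metis line_of_hpoint line_of_inject)
  also have "\<dots> \<longleftrightarrow> w \<in> span {v}"
  proof
    assume "span {v} = span {w}"
    then show "w \<in> span {v}" by (simp add: span_base)
  next
    assume "w \<in> span {v}"
    then obtain k where k: "w = k *\<^sub>R v" by (auto simp: span_singleton)
    then have "v = (1/k) *\<^sub>R w" using assms by auto
    then have "v \<in> span {w}" by (metis span_base span_scale singletonI)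
    with \<open>w \<in> span {v}\<close> show "span {v} = span {w}"
      by (simp add: span_minimal subset_antisym)
  qed
  finally show ?thesis by (auto simp: span_singleton)
qed

lemma hpoint_eqD:
  assumes "hpoint v = hpoint w" "v \<noteq> 0" "w \<noteq> 0"
  obtains k where "k \<noteq> 0" "w = k *\<^sub>R v"
  using assms hpoint_eq_iff[of v w] by force

lemma hpoint_scaleR: "k \<noteq> 0 \<Longrightarrow> v \<noteq> 0 \<Longrightarrow> hpoint (k *\<^sub>R v) = hpoint v"
  by (metis hpoint_eq_iff scaleR_eq_0_iff)

lemma chart_embed_inject: "chart_embed x = chart_embed y \<longleftrightarrow> x = y"
proof
  assume "chart_embed x = chart_embed y"
  then obtain k where "homog y = k *\<^sub>R homog x"
    by (auto simp: chart_embed_homog elim: hpoint_eqD)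
  then show "x = y" by (simp add: vec_eq_iff forall_3 forall_2)
qed simp

lemma affine_point_chart_embed [simp]: "affine_point (chart_embed x) = x"
  unfolding affine_point_def by (rule the_equality) (auto simp: chart_embed_inject)

lemma hpoint_dehomog: "v$3 \<noteq> 0 \<Longrightarrow> hpoint v = chart_embed (dehomog v)"
  by (metis chart_embed_homog homog_nonzero hpoint_scaleR scaleR_homog_dehomog)

lemma affine_point_hpoint: "v$3 \<noteq> 0 \<Longrightarrow> affine_point (hpoint v) = dehomog v"
  by (simp add: hpoint_dehomog)

lemma projectivity_hpoint: "v \<noteq> 0 \<Longrightarrow> projectivity N (hpoint v) = hpoint (N *v v)"
  using linear_span_image[OF matrix_vector_mul_linear, of N "{v}"]
  by (simp add: projectivity_def line_of_hpoint) (simp add: hpoint_def)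

lemma invertible_mult_nonzero:
  fixes N :: "real^'n^'n"
  shows "invertible N \<Longrightarrow> v \<noteq> 0 \<Longrightarrow> N *v v \<noteq> 0"
  by (metis invertible_eq_bij matrix_vector_mult_0_right bij_def injD)

lemma funpow_matrix_nonzero:
  fixes N :: "real^'n^'n"
  shows "invertible N \<Longrightarrow> v \<noteq> 0 \<Longrightarrow> ((*v) N ^^ q) v \<noteq> 0"
  by (induction q) (auto simp: invertible_mult_nonzero)

lemma funpow_projectivity_hpoint:
  "invertible N \<Longrightarrow> v \<noteq> 0 \<Longrightarrow> (projectivity N ^^ q) (hpoint v) = hpoint (((*v) N ^^ q) v)"
  by (induction q) (auto simp: projectivity_hpoint funpow_matrix_nonzero)

section \<open>Lines in the plane and their intersections\<close>

definition cross2 :: "real^2 \<Rightarrow> real^2 \<Rightarrow> real" where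
  "cross2 u v = u$1 * v$2 - u$2 * v$1"

lemma det_vector_2: "det (vector [u, v] :: real^2^2) = cross2 u v"
  by (simp add: det_2 cross2_def)

lemma cross2_simps:
  "cross2 (u + v) w = cross2 u w + cross2 v w" "cross2 u (v + w) = cross2 u v + cross2 u w"
  "cross2 (u - v) w = cross2 u w - cross2 v w" "cross2 u (v - w) = cross2 u v - cross2 u w"
  "cross2 (k *\<^sub>R u) w = k * cross2 u w" "cross2 u (k *\<^sub>R w) = k * cross2 u w"
  "cross2 (- u) w = - cross2 u w" "cross2 u (- w) = - cross2 u w"
  "cross2 u u = 0" "cross2 0 u = 0" "cross2 u 0 = 0"
  by (simp_all add: cross2_def algebra_simps)

lemma cross2_commute: "cross2 u v = - cross2 v u"
  by (simp add: cross2_def)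

lemma mem_line: "x \<in> line a b \<longleftrightarrow> (\<exists>t. x = a + t *\<^sub>R (b - a))"
  by (auto simp: line_def affine_hull_2_alt)

lemma cross2_eq_0D:
  assumes "cross2 u v = 0" "u \<noteq> 0"
  obtains k where "v = k *\<^sub>R u"
proof (cases "u$1 = 0")
  case True
  with assms have "u$2 \<noteq> 0" "v$1 = 0"
    by (auto simp: cross2_def vec_eq_iff forall_2)
  with True that[of "v$2 / u$2"] show ?thesis by (simp add: vec_eq_iff forall_2)
next
  case False
  then have "v = (v$1 / u$1) *\<^sub>R u"
    using assms(1) by (simp add: vec_eq_iff forall_2 cross2_def field_simps)
  with that show ?thesis by blast
qed

lemma cross2_nonzero_of_not_parallel:
  assumes "\<not> affine_parallel (line a b) (line c d)" "a \<noteq> b" "c \<noteq> d"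
  shows "cross2 (b - a) (d - c) \<noteq> 0"
proof
  assume "cross2 (b - a) (d - c) = 0"
  with assms(2) obtain k where k: "d - c = k *\<^sub>R (b - a)"
    by (metis cross2_eq_0D right_minus_eq)
  with assms(3) have k0: "k \<noteq> 0" by auto
  have "line c d = (\<lambda>x. (c - a) + x) ` line a b"
  proof (intro set_eqI iffI)
    fix x assume "x \<in> line c d"
    then obtain t where t: "x = c + t *\<^sub>R (d - c)" by (auto simp: mem_line)
    then have "x = (c - a) + (a + (t * k) *\<^sub>R (b - a))" by (simp add: k)
    then show "x \<in> (\<lambda>x. (c - a) + x) ` line a b" by (metis imageI mem_line)
  next
    fix x assume "x \<in> (\<lambda>x. (c - a) + x) ` line a b"
    then obtain t where "x = (c - a) + (a + t *\<^sub>R (b - a))" unfolding mem_line image_iff Bex_def by blast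
    then have "x = c + (t / k) *\<^sub>R (d - c)" using k0 by (simp add: k)
    then show "x \<in> line c d" by (metis mem_line)
  qed
  then have "affine_parallel (line a b) (line c d)" unfolding affine_parallel_def by blast
  with assms(1) show False by blast
qed

text \<open>The difference of two common points is a multiple of both directions, so its cross
  product with \<open>d - c\<close> is zero and at the same time a multiple of a nonzero
  number.\<close>

lemma line_inter_unique:
  assumes "cross2 (b - a) (d - c) \<noteq> 0" "x \<in> line a b \<inter> line c d" "y \<in> line a b \<inter> line c d"
  shows "x = y"
proof -
  from assms(2) obtain s s' where x: "x = a + s *\<^sub>R (b - a)" "x = c + s' *\<^sub>R (d - c)"
    unfolding mem_line Int_iff by blast
  from assms(3) obtain t t' where y: "y = a + t *\<^sub>R (b - a)" "y = c + t' *\<^sub>R (d - c)"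
    unfolding mem_line Int_iff by blast
  have 1: "y - x = (t - s) *\<^sub>R (b - a)"
    unfolding x(1) y(1) by (simp add: scaleR_left_diff_distrib)
  have 2: "y - x = (t' - s') *\<^sub>R (d - c)"
    unfolding x(2) y(2) by (simp add: scaleR_left_diff_distrib)
  have "(t - s) * cross2 (b - a) (d - c) = cross2 (y - x) (d - c)" unfolding 1 by (rule cross2_simps(5)[symmetric])
  also have "\<dots> = 0" unfolding 2 by (simp add: cross2_simps(5,9))
  finally have "t - s = 0" using assms(1) by simp
  with 1 show ?thesis by simp
qed

lemma line_inter_exists:
  assumes D: "cross2 (b - a) (d - c) \<noteq> 0"
  shows "\<exists>x. x \<in> line a b \<inter> line c d"
proof -
  \<comment> \<open>Cramer's rule: the parameter t for which a + t (b - a) - c is parallel to d -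
    c.\<close>
  define x where "x = a + (cross2 (c - a) (d - c) / cross2 (b - a) (d - c)) *\<^sub>R (b - a)"
  have "x - c = (cross2 (c - a) (d - c) / cross2 (b - a) (d - c)) *\<^sub>R (b - a) - (c - a)"
    by (simp add: x_def)
  then have "cross2 (d - c) (x - c) =
      cross2 (c - a) (d - c) / cross2 (b - a) (d - c) * cross2 (d - c) (b - a) - cross2 (d - c) (c - a)"
    by (simp only: cross2_simps(4,6))
  also have "\<dots> = 0"
    using D by (simp add: cross2_commute[of "d - c"])
  finally have "cross2 (d - c) (x - c) = 0" .
  moreover have "d - c \<noteq> 0" using D by (auto simp: cross2_simps)
  ultimately obtain k where "x - c = k *\<^sub>R (d - c)" by (rule cross2_eq_0D)
  then have "x = c + k *\<^sub>R (d - c)" by (simp add: algebra_simps)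
  then have "x \<in> line c d" unfolding mem_line by (rule exI)
  moreover have "x \<in> line a b" unfolding mem_line x_def by (rule exI) (rule refl)
  ultimately show ?thesis by blast
qed

section \<open>The pentagram map under relabelling, homotheties and projectivities\<close>

lemma pentagram_defined_cross2:
  assumes "pentagram_defined P"
  shows "cross2 (P (i + 2) - P i) (P (i + 3) - P (i + 1)) \<noteq> 0"
  using assms[unfolded pentagram_defined_def, rule_format, of i]
  by (intro cross2_nonzero_of_not_parallel) simp_all

lemma pentagram_eqI:
  assumes "cross2 (P (i + 2) - P i) (P (i + 3) - P (i + 1)) \<noteq> 0"
    and "x \<in> line (P i) (P (i + 2))" "x \<in> line (P (i + 1)) (P (i + 3))"
  shows "pentagram P i = x"
  unfolding pentagram_def
proof (rule the_equality)
  show x: "x \<in> line (P i) (P (i + 2)) \<inter> line (P (i + 1)) (P (i + 3))" using assms(2,3) by (rule IntI)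
  show "y = x" if "y \<in> line (P i) (P (i + 2)) \<inter> line (P (i + 1)) (P (i + 3))" for y
    using that x by (rule line_inter_unique[OF assms(1)])
qed

lemma pentagram_mem:
  assumes "pentagram_defined P"
  shows "pentagram P i \<in> line (P i) (P (i + 2))" "pentagram P i \<in> line (P (i + 1)) (P (i + 3))"
proof -
  note D = pentagram_defined_cross2[OF assms, of i]
  from line_inter_exists[OF D] obtain x
    where "x \<in> line (P i) (P (i + 2))" "x \<in> line (P (i + 1)) (P (i + 3))" by blast
  with pentagram_eqI[OF D this] show "pentagram P i \<in> line (P i) (P (i + 2))"
    "pentagram P i \<in> line (P (i + 1)) (P (i + 3))" by simp_all
qed

lemma pentagram_shift: "pentagram (\<lambda>i. P (i + s)) i = pentagram P (i + s)"
  by (simp add: pentagram_def algebra_simps)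

lemma pentagram_defined_shift: "pentagram_defined P \<Longrightarrow> pentagram_defined (\<lambda>i. P (i + s))"
  unfolding pentagram_defined_def
  by (intro allI, drule_tac x = "i + s" in spec) (simp add: algebra_simps)

lemma homothety_mem_line: "x \<in> line a b \<Longrightarrow> z + k *\<^sub>R x \<in> line (z + k *\<^sub>R a) (z + k *\<^sub>R b)"
proof -
  assume "x \<in> line a b"
  then obtain t where x: "x = a + t *\<^sub>R (b - a)" unfolding mem_line by (rule exE)
  have "z + k *\<^sub>R x = (z + k *\<^sub>R a) + t *\<^sub>R ((z + k *\<^sub>R b) - (z + k *\<^sub>R a))"
    unfolding x by (simp add: algebra_simps)
  then show ?thesis unfolding mem_line by (rule exI)
qed

lemma pentagram_homothety:
  assumes "pentagram_defined P" "k \<noteq> 0"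
  shows "pentagram (\<lambda>i. z + k *\<^sub>R P i) i = z + k *\<^sub>R pentagram P i"
proof (rule pentagram_eqI)
  have *: "cross2 ((z + k *\<^sub>R b) - (z + k *\<^sub>R a)) ((z + k *\<^sub>R d) - (z + k *\<^sub>R c)) = k\<^sup>2 * cross2 (b - a) (d - c)"
    for a b c d by (simp add: cross2_def algebra_simps power2_eq_square)
  show "cross2 ((z + k *\<^sub>R P (i + 2)) - (z + k *\<^sub>R P i)) ((z + k *\<^sub>R P (i + 3)) - (z + k *\<^sub>R P (i + 1))) \<noteq> 0"
    unfolding * using pentagram_defined_cross2[OF assms(1), of i] assms(2) by auto
qed (intro homothety_mem_line pentagram_mem assms)+

text \<open>The two lines lift to planes through the origin of 3-space, which meet in the line
  spanned by the lift of \<open>x\<close>. The point of \<open>h\<close> could a priori lie at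
  infinity; then its horizontal part would be parallel to both directions, which forces
  \<open>h = 0\<close>.\<close>

lemma homog_line_inter:
  assumes D: "cross2 (b - a) (d - c) \<noteq> 0"
    and h: "h = s *\<^sub>R homog a + t *\<^sub>R homog b" "h = s' *\<^sub>R homog c + t' *\<^sub>R homog d"
    and x: "x \<in> line a b \<inter> line c d"
  shows "h = h$3 *\<^sub>R homog x"
proof -
  have h1: "h$i = s * homog a $ i + t * homog b $ i" and h2: "h$i = s' * homog c $ i + t' * homog d $ i" for i
    using arg_cong[OF h(1), of "\<lambda>v. v $ i"] arg_cong[OF h(2), of "\<lambda>v. v $ i"] by simp_all
  have ab: "vector [h$1, h$2] = h$3 *\<^sub>R a + t *\<^sub>R (b - a)"
    unfolding h1 by (simp add: vec_eq_iff forall_2 algebra_simps)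
  have cd: "vector [h$1, h$2] = h$3 *\<^sub>R c + t' *\<^sub>R (d - c)"
    unfolding h2 by (simp add: vec_eq_iff forall_2 algebra_simps)
  show ?thesis
  proof (cases "h$3 = 0")
    case True
    have "t * cross2 (b - a) (d - c) = cross2 (t *\<^sub>R (b - a)) (d - c)" by (simp add: cross2_simps(5))
    also have "t *\<^sub>R (b - a) = t' *\<^sub>R (d - c)" using ab cd True by simp
    also have "cross2 \<dots> (d - c) = 0" by (simp add: cross2_simps(5,9))
    finally have "t = 0" using D by simp
    moreover from this have "s = 0" using h1[of 3] True by simp
    ultimately show ?thesis using True h(1) by simp
  next
    case False
    have "dehomog h = a + (t / h$3) *\<^sub>R (b - a)"
      using False unfolding dehomog_def ab by (simp add: scaleR_right_distrib)
    moreover have "dehomog h = c + (t' / h$3) *\<^sub>R (d - c)"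
      using False unfolding dehomog_def cd by (simp add: scaleR_right_distrib)
    ultimately have "dehomog h \<in> line a b \<inter> line c d" unfolding Int_iff mem_line by (rule conjI[OF exI exI])
    then have "dehomog h = x" using x by (rule line_inter_unique[OF D])
    then show ?thesis using False scaleR_homog_dehomog by metis
  qed
qed

lemma homog_mem_line: "x \<in> line a b \<Longrightarrow> \<exists>s t. homog x = s *\<^sub>R homog a + t *\<^sub>R homog b"
proof -
  assume "x \<in> line a b"
  then obtain t where "x = a + t *\<^sub>R (b - a)" unfolding mem_line by blast
  then have "homog x = (1 - t) *\<^sub>R homog a + t *\<^sub>R homog b"
    by (simp add: vec_eq_iff forall_3 algebra_simps)
  then show ?thesis by blast
qed

text \<open>A projectivity may send chart points to infinity, so the argument runs on lifts:
  \<open>N\<close> maps the lift of the intersection point to a nonzero vector in both planes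
  spanned by lifts of \<open>Q\<close>. That the pentagram map is defined at \<open>Q\<close> then
  identifies this vector with a multiple of the lift of \<open>pentagram Q i\<close>.\<close>

lemma pentagram_projectivity:
  assumes N: "invertible N" and P: "pentagram_defined P" and Q: "pentagram_defined Q"
    and PQ: "\<And>i. chart_embed (Q i) = projectivity N (chart_embed (P i))"
  shows "chart_embed (pentagram Q i) = projectivity N (chart_embed (pentagram P i))"
proof -
  have "\<exists>k. N *v homog (P i) = k *\<^sub>R homog (Q i)" for i
  proof -
    have "hpoint (homog (Q i)) = hpoint (N *v homog (P i))"
      using PQ[of i] by (simp only: chart_embed_homog projectivity_hpoint homog_nonzero not_False_eq_True)
    then show ?thesis
      using hpoint_eq_iff[OF homog_nonzero invertible_mult_nonzero[OF N homog_nonzero]] by blast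
  qed
  then obtain k where k: "\<And>i. N *v homog (P i) = k i *\<^sub>R homog (Q i)" by metis
  define h where "h = N *v homog (pentagram P i)"
  obtain s t where "homog (pentagram P i) = s *\<^sub>R homog (P i) + t *\<^sub>R homog (P (i + 2))"
    using homog_mem_line[OF pentagram_mem(1)[OF P]] by blast
  then have 1: "h = (s * k i) *\<^sub>R homog (Q i) + (t * k (i + 2)) *\<^sub>R homog (Q (i + 2))"
    by (simp add: h_def matrix_vector_right_distrib matrix_vector_mult_scaleR k)
  obtain s' t' where "homog (pentagram P i) = s' *\<^sub>R homog (P (i + 1)) + t' *\<^sub>R homog (P (i + 3))"
    using homog_mem_line[OF pentagram_mem(2)[OF P]] by blast
  then have 2: "h = (s' * k (i + 1)) *\<^sub>R homog (Q (i + 1)) + (t' * k (i + 3)) *\<^sub>R homog (Q (i + 3))"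
    by (simp add: h_def matrix_vector_right_distrib matrix_vector_mult_scaleR k)
  have "h = h$3 *\<^sub>R homog (pentagram Q i)"
    using pentagram_mem[OF Q] by (intro homog_line_inter[OF pentagram_defined_cross2[OF Q] 1 2]) auto
  moreover have "h \<noteq> 0" by (simp add: h_def invertible_mult_nonzero N)
  ultimately have "hpoint (homog (pentagram Q i)) = hpoint h"
    using hpoint_eq_iff[OF homog_nonzero] by blast
  then show ?thesis unfolding h_def chart_embed_homog by (simp only: projectivity_hpoint homog_nonzero not_False_eq_True)
qed

subsection \<open>Area normalization\<close>

text \<open>A shift by one suffices: both sums extend to the interval from 1 to n + 1, and the two
  added end terms agree by periodicity. Integer induction then covers shifts of either sign.\<close>

lemma periodic_sum_shift:
  fixes f :: "int \<Rightarrow> 'a::ab_group_add"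
  assumes per: "\<And>i. f (i + int n) = f i"
  shows "(\<Sum>i\<in>{1..int n}. f (i + s)) = (\<Sum>i\<in>{1..int n}. f i)"
proof -
  have step: "(\<Sum>i\<in>{1..int n}. f (i + (s + 1))) = (\<Sum>i\<in>{1..int n}. f (i + s))" for s
  proof -
    have "(\<Sum>i\<in>{1..int n}. f (i + (s + 1))) = (\<Sum>i\<in>{2..int n + 1}. f (i + s))"
      by (rule sum.reindex_bij_witness[of _ "\<lambda>i. i - 1" "\<lambda>i. i + 1"]) (auto simp: algebra_simps)
    also have "\<dots> + f (1 + s) = (\<Sum>i\<in>insert 1 {2..int n + 1}. f (i + s))"
      by (subst sum.insert) (auto simp: add.commute)
    also have "insert 1 {2..int n + 1} = insert (int n + 1) {1..int n}" by auto
    also have "(\<Sum>i\<in>insert (int n + 1) {1..int n}. f (i + s)) = f (1 + s + int n) + (\<Sum>i\<in>{1..int n}. f (i + s))"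
      by (subst sum.insert) (auto simp: algebra_simps)
    also have "\<dots> = f (1 + s) + (\<Sum>i\<in>{1..int n}. f (i + s))"
      using per by simp
    finally show ?thesis by simp
  qed
  show ?thesis
  proof (induction s rule: int_induct[where k = 0])
    case base
    show ?case by simp
  next
    case (step1 i)
    then show ?case using step by simp
  next
    case (step2 i)
    then show ?case using step[of "i - 1"] by simp
  qed
qed

lemma periodic_image_shift:
  fixes f :: "int \<Rightarrow> 'a"
  assumes per: "\<And>i. f (i + int n) = f i" and n: "1 \<le> n"
  shows "(\<lambda>i. f (i + s)) ` {1..int n} = f ` {1..int n}"
proof -
  have mult: "f (i + int n * k) = f i" for i k
  proof (induction k rule: int_induct[where k = 0])
    case (step1 j)
    then show ?case using per[of "i + int n * j"] by (simp add: algebra_simps)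
  next
    case (step2 j)
    then show ?case using per[of "i + int n * (j - 1)"] by (simp add: algebra_simps)
  qed simp
  have "f i \<in> f ` {1..int n}" for i
  proof -
    \<comment> \<open>The index range starts at 1, so the representative of \<open>i\<close> modulo
      \<open>n\<close> is taken in 1, ..., n.\<close>
    have "f i = f ((i - 1) mod int n + 1)"
      using mult[of "(i - 1) mod int n + 1" "(i - 1) div int n"] by (simp add: algebra_simps)
    moreover have "(i - 1) mod int n + 1 \<in> {1..int n}"
      using n pos_mod_bound[of "int n" "i - 1"] pos_mod_sign[of "int n" "i - 1"]
      by (simp del: pos_mod_bound pos_mod_sign)
    ultimately show ?thesis by blast
  qed
  moreover have "f i \<in> (\<lambda>i. f (i + s)) ` {1..int n}" for i
  proof -
    have "f i = f ((i - s - 1) mod int n + 1 + s)"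
      using mult[of "(i - s - 1) mod int n + 1 + s" "(i - s - 1) div int n"] by (simp add: algebra_simps)
    moreover have "(i - s - 1) mod int n + 1 \<in> {1..int n}"
      using n pos_mod_bound[of "int n" "i - s - 1"] pos_mod_sign[of "int n" "i - s - 1"]
      by (simp del: pos_mod_bound pos_mod_sign)
    ultimately show ?thesis by blast
  qed
  ultimately show ?thesis by blast
qed

section \<open>Centroid and area under relabelling and affine maps\<close>

lemma centroid_linear:
  assumes "1 \<le> n" "linear L"
  shows "centroid n (\<lambda>i. z + L (P i)) = z + L (centroid n P)"
proof -
  have "(\<Sum>i\<in>{1..int n}. z) = real n *\<^sub>R z"
    by (simp only: sum_constant_scaleR) simp
  then show ?thesis
    using assms
    by (simp add: centroid_def sum.distrib scaleR_right_distrib linear_sum linear_scale o_def)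
qed

lemma centroid_shift:
  assumes "ngon n P"
  shows "centroid n (\<lambda>i. P (i + s)) = centroid n P"
  using assms periodic_sum_shift[of P n s] by (simp add: centroid_def ngon_def)

lemma area_cross2: "area n P = \<bar>(1/2) * (\<Sum>i\<in>{1..int n}. cross2 (P i) (P (i + 1)))\<bar>"
  by (simp add: area_def det_vector_2)

lemma area_shift:
  assumes "ngon n P"
  shows "area n (\<lambda>i. P (i + s)) = area n P"
proof -
  have "(\<Sum>i\<in>{1..int n}. cross2 (P (i + s)) (P (i + s + 1))) = (\<Sum>i\<in>{1..int n}. cross2 (P i) (P (i + 1)))"
    using assms by (intro periodic_sum_shift[of "\<lambda>i. cross2 (P i) (P (i + 1))"])
      (metis ngon_def add.assoc add.commute)
  then show ?thesis by (simp add: area_cross2 add.assoc add.commute[of 1])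
qed

text \<open>The translation contributes \<open>cross2 z S + cross2 S z\<close>, which is zero; the
  same \<open>S\<close> occurs in both terms because a periodic sum is unaffected by the shift from
  \<open>i\<close> to \<open>i + 1\<close>.\<close>

lemma area_linear:
  assumes n: "ngon n P" and L: "linear L" and D: "\<And>u v. cross2 (L u) (L v) = D * cross2 u v"
  shows "area n (\<lambda>i. z + L (P i)) = \<bar>D\<bar> * area n P"
proof -
  define S where "S = (\<Sum>i\<in>{1..int n}. L (P i))"
  have S1: "(\<Sum>i\<in>{1..int n}. L (P (i + 1))) = S"
    unfolding S_def using n periodic_sum_shift[of "\<lambda>i. L (P i)" n 1] by (simp add: ngon_def)
  have lin1: "linear (\<lambda>x. cross2 z x)" and lin2: "linear (\<lambda>x. cross2 x z)"
    by (auto intro!: linearI simp: cross2_simps)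
  have "(\<Sum>i\<in>{1..int n}. cross2 (z + L (P i)) (z + L (P (i + 1)))) =
      (\<Sum>i\<in>{1..int n}. D * cross2 (P i) (P (i + 1)) + (cross2 z (L (P (i + 1))) + cross2 (L (P i)) z))"
    by (simp add: cross2_simps(1,2,9) D algebra_simps)
  also have "\<dots> = D * (\<Sum>i\<in>{1..int n}. cross2 (P i) (P (i + 1))) + (cross2 z S + cross2 S z)"
    unfolding sum.distrib sum_distrib_left[symmetric] S_def linear_sum[OF lin2]
    unfolding linear_sum[OF lin1, symmetric] S1 S_def ..
  also have "\<dots> = D * (\<Sum>i\<in>{1..int n}. cross2 (P i) (P (i + 1)))"
    by (simp add: cross2_commute[of z])
  finally show ?thesis by (simp add: area_cross2 abs_mult)
qed

lemma centroid_homothety: "1 \<le> n \<Longrightarrow> centroid n (\<lambda>i. z + k *\<^sub>R P i) = z + k *\<^sub>R centroid n P"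
  by (rule centroid_linear) (auto intro: linear_scale_self)

lemma area_homothety: "ngon n P \<Longrightarrow> area n (\<lambda>i. z + k *\<^sub>R P i) = k\<^sup>2 * area n P"
  using area_linear[of n P "\<lambda>x. k *\<^sub>R x" "k\<^sup>2" z]
  by (simp add: linear_scale_self cross2_simps(5,6) power2_eq_square mult.assoc)

lemma cross2_matrix: "cross2 (M *v u) (M *v v) = det M * cross2 u v"
  by (simp add: cross2_def det_2 matrix_vector_mult_def sum_2 algebra_simps)

lemma ngon_pentagram: "ngon n P \<Longrightarrow> ngon n (pentagram P)"
  unfolding ngon_def by (metis (no_types, lifting) ext pentagram_shift)

lemma ngon_funpow_pentagram: "ngon n P \<Longrightarrow> ngon n ((pentagram ^^ k) P)"
  by (induction k) (auto simp: ngon_pentagram)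

text \<open>Normalization composes with a homothety at every step, so only the last one survives.\<close>

lemma funpow_normalized_pentagram:
  assumes n: "ngon n P"
    and dfd: "\<And>k. pentagram_defined ((pentagram ^^ k) P)"
    and area: "\<And>k. area n ((pentagram ^^ k) P) \<noteq> 0"
  shows "(normalized_pentagram n ^^ k) P = (\<lambda>i. centroid n P +
      sqrt (area n P / area n ((pentagram ^^ k) P)) *\<^sub>R
        ((pentagram ^^ k) P i - centroid n ((pentagram ^^ k) P)))"
proof (induction k)
  case 0
  then show ?case using area[of 0] by simp
next
  case (Suc k)
  define Q where "Q = (pentagram ^^ k) P"
  define a where "a = sqrt (area n P / area n Q)"
  \<comment> \<open>With this \<open>z\<close> the normalized polygon after \<open>k\<close> steps
    is the image of \<open>Q\<close> under the homothety x -> z + a x, so the next step only needs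
    the behaviour of the pentagram map, centroid and area under homotheties.\<close>
  define z where "z = centroid n P - a *\<^sub>R centroid n Q"
  have n1: "1 \<le> n" and nQ: "ngon n Q" and nT: "ngon n (pentagram Q)"
    using n by (simp_all add: ngon_def[of n P] Q_def ngon_funpow_pentagram ngon_pentagram)
  have pos: "0 < area n ((pentagram ^^ j) P)" for j
    using area[of j] unfolding area_def by (simp add: less_le)
  have P0: "0 < area n P" and Q0: "0 < area n Q" and T0: "0 < area n (pentagram Q)"
    using pos[of 0] pos[of k] pos[of "Suc k"] by (simp_all add: Q_def)
  then have a0: "0 < a" and a2: "a\<^sup>2 = area n P / area n Q"
    by (simp_all add: a_def)
  have Y: "(normalized_pentagram n ^^ k) P = (\<lambda>i. z + a *\<^sub>R Q i)"
    unfolding Suc.IH by (simp add: z_def a_def Q_def algebra_simps)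
  have TY: "pentagram (\<lambda>i. z + a *\<^sub>R Q i) = (\<lambda>i. z + a *\<^sub>R pentagram Q i)"
    using dfd[of k] a0 by (intro ext pentagram_homothety) (simp_all add: Q_def)
  have cY: "centroid n (\<lambda>i. z + a *\<^sub>R Q i) = centroid n P"
    unfolding centroid_homothety[OF n1] by (simp add: z_def)
  have "area n (\<lambda>i. z + a *\<^sub>R Q i) / area n (\<lambda>i. z + a *\<^sub>R pentagram Q i) =
      (area n P / area n (pentagram Q)) / a\<^sup>2"
    unfolding area_homothety[OF nQ] area_homothety[OF nT] a2 using Q0 P0 T0 by (simp add: field_simps)
  \<comment> \<open>The factor \<open>a\<close> already carried by the polygon cancels the
    \<open>a\<^sup>2\<close> under the root, and with it every dependence on the area of
    \<open>Q\<close>.\<close>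
  then have sq: "sqrt (area n (\<lambda>i. z + a *\<^sub>R Q i) / area n (\<lambda>i. z + a *\<^sub>R pentagram Q i)) * a
      = sqrt (area n P / area n (pentagram Q))"
    using a0 by (simp add: real_sqrt_divide real_sqrt_mult)
  have "(normalized_pentagram n ^^ Suc k) P = (\<lambda>i. centroid n P +
      sqrt (area n (\<lambda>i. z + a *\<^sub>R Q i) / area n (\<lambda>i. z + a *\<^sub>R pentagram Q i)) *\<^sub>R
        (a *\<^sub>R (pentagram Q i - centroid n (pentagram Q))))"
  proof (rule ext)
    fix i
    have "(normalized_pentagram n ^^ Suc k) P i = centroid n P +
      sqrt (area n (\<lambda>i. z + a *\<^sub>R Q i) / area n (\<lambda>i. z + a *\<^sub>R pentagram Q i)) *\<^sub>R
        (z + a *\<^sub>R pentagram Q i - centroid n (\<lambda>i. z + a *\<^sub>R pentagram Q i))"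
      by (simp only: funpow.simps(2) o_apply Y normalized_pentagram_def TY cY)
    also have "z + a *\<^sub>R pentagram Q i - centroid n (\<lambda>i. z + a *\<^sub>R pentagram Q i) =
        a *\<^sub>R (pentagram Q i - centroid n (pentagram Q))"
      unfolding centroid_homothety[OF n1] by (simp add: scaleR_right_diff_distrib)
    finally show "(normalized_pentagram n ^^ Suc k) P i = centroid n P +
      sqrt (area n (\<lambda>i. z + a *\<^sub>R Q i) / area n (\<lambda>i. z + a *\<^sub>R pentagram Q i)) *\<^sub>R
        (a *\<^sub>R (pentagram Q i - centroid n (pentagram Q)))" .
  qed
  also have "\<dots> = (\<lambda>i. centroid n P +
      sqrt (area n P / area n (pentagram Q)) *\<^sub>R (pentagram Q i - centroid n (pentagram Q)))"
    unfolding scaleR_scaleR sq ..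
  finally show ?case by (simp add: Q_def)
qed

text \<open>The pentagram map commutes with \<open>G\<close> and with relabelling, so the return
  relation propagates to all later polygons, and each return adds a shift by \<open>s\<close>. As
  the left side is a chart point, the iterates of \<open>G\<close> on these vertices never leave the
  chart.\<close>

lemma return_relation_iterate:
  assumes ret: "return_relation n P m s (projectivity N)" and N: "invertible N"
  shows "chart_embed ((pentagram ^^ (q * m + r)) P i) =
    (projectivity N ^^ q) (chart_embed ((pentagram ^^ r) P (i + int q * s)))"
proof -
  have dfd: "pentagram_defined ((pentagram ^^ k) P)" for k
    using ret by (simp add: return_relation_def)
  have base: "chart_embed ((pentagram ^^ m) P i) = projectivity N (chart_embed (P (i + s)))" for i
    using ret unfolding return_relation_def relabel_def by meson
  have step: "chart_embed ((pentagram ^^ (m + k)) P i) = projectivity N (chart_embed ((pentagram ^^ k) P (i + s)))"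
    for k i
  proof (induction k arbitrary: i)
    case 0
    then show ?case using base by simp
  next
    case (Suc k)
    have "chart_embed (pentagram ((pentagram ^^ (m + k)) P) i) =
        projectivity N (chart_embed (pentagram (\<lambda>i. (pentagram ^^ k) P (i + s)) i))"
      using dfd Suc.IH by (intro pentagram_projectivity N pentagram_defined_shift)
    then show ?case by (simp add: pentagram_shift)
  qed
  show ?thesis
  proof (induction q arbitrary: i)
    case (Suc q)
    have "chart_embed ((pentagram ^^ (Suc q * m + r)) P i) =
        projectivity N (chart_embed ((pentagram ^^ (q * m + r)) P (i + s)))"
      using step[of "q * m + r" i] by (simp add: add.assoc)
    also have "\<dots> = (projectivity N ^^ Suc q) (chart_embed ((pentagram ^^ r) P (i + s + int q * s)))"
      by (simp add: Suc.IH)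
    finally show ?case by (simp add: algebra_simps)
  qed simp
qed

subsection \<open>Ellipses\<close>

text \<open>The constant is the minimum of the form on the compact unit sphere.\<close>

lemma sym_posdef_coercive:
  fixes H :: "real^'n^'n"
  assumes "sym_posdef H"
  obtains c where "0 < c" "\<And>x. c * (norm x)\<^sup>2 \<le> x \<bullet> (H *v x)"
proof -
  let ?Q = "\<lambda>x :: real^'n. x \<bullet> (H *v x)"
  have cont: "continuous_on (sphere 0 1) ?Q"
    by (intro continuous_intros matrix_vector_mult_linear_continuous_on)
  have "sphere (0 :: real^'n) 1 \<noteq> {}" by simp
  then obtain u where u: "u \<in> sphere 0 1" "\<And>x. x \<in> sphere 0 1 \<Longrightarrow> ?Q u \<le> ?Q x"
    using continuous_attains_inf[OF compact_sphere _ cont] by blast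
  have "u \<noteq> 0" using u(1) by auto
  then have "0 < ?Q u" using assms by (simp add: sym_posdef_def)
  moreover have "?Q u * (norm x)\<^sup>2 \<le> ?Q x" for x
  proof (cases "x = 0")
    case False
    have "?Q u \<le> ?Q ((1 / norm x) *\<^sub>R x)"
      using False by (intro u(2)) simp
    also have "\<dots> = ?Q x / (norm x)\<^sup>2"
      by (simp add: matrix_vector_mult_scaleR power2_eq_square)
    finally show ?thesis using False by (simp add: field_simps)
  qed simp
  ultimately show ?thesis using that by blast
qed

lemma ellipse_rescale:
  assumes "k \<noteq> 0"
  shows "ellipse C (k *\<^sub>R H) (k * t) = ellipse C H t"
  using assms by (simp add: ellipse_def flip: scaleR_matrix_vector_assoc)

lemma quadratic_form_scaleR:
  fixes H :: "real^'n^'n"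
  shows "(k *\<^sub>R x) \<bullet> (H *v (k *\<^sub>R x)) = k\<^sup>2 * (x \<bullet> (H *v x))"
  by (simp add: matrix_vector_mult_scaleR power2_eq_square)

text \<open>The form scales by the square of the ratio, hence the root. The two centres are
  independent so that orbits of different polygons, with different centroids, can be
  compared.\<close>

lemma ellipse_homothety:
  assumes "0 < t" "0 < t'"
  shows "ellipse C' H t' = (\<lambda>y. C' + sqrt (t' / t) *\<^sub>R (y - C)) ` ellipse C H t"
proof -
  let ?k = "sqrt (t' / t)"
  have k: "0 < ?k" "?k\<^sup>2 = t' / t" using assms by simp_all
  show ?thesis
  proof (intro set_eqI iffI)
    fix y assume y: "y \<in> ellipse C' H t'"
    define x where "x = C + (1 / ?k) *\<^sub>R (y - C')"
    have "(1 / ?k)\<^sup>2 = t / t'" unfolding power_divide k(2) by simp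
    then have "x \<in> ellipse C H t"
      using y assms unfolding ellipse_def mem_Collect_eq x_def add_diff_cancel_left' quadratic_form_scaleR
      by simp
    moreover have "y = C' + ?k *\<^sub>R (x - C)" using assms by (simp add: x_def)
    ultimately show "y \<in> (\<lambda>y. C' + ?k *\<^sub>R (y - C)) ` ellipse C H t" by (rule rev_image_eqI)
  next
    fix y assume "y \<in> (\<lambda>y. C' + ?k *\<^sub>R (y - C)) ` ellipse C H t"
    then obtain x where x: "x \<in> ellipse C H t" "y = C' + ?k *\<^sub>R (x - C)" by (rule imageE)
    show "y \<in> ellipse C' H t'"
      using x assms unfolding ellipse_def mem_Collect_eq x(2) add_diff_cancel_left' quadratic_form_scaleR k(2)
      by simp
  qed
qed

text \<open>Rescaling \<open>y q - C\<close> radially by \<open>sqrt (t / a q)\<close>, where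
  \<open>a q\<close> is the value of the form there, lands on the ellipse. The displacement is
  \<bar>1 - sqrt (t / a q)\<bar> times the norm of \<open>y q - C\<close>, and coercivity bounds
  that norm.\<close>

lemma infdist_ellipse_tendsto_0:
  assumes H: "sym_posdef H" and t: "0 < t"
    and lim: "(\<lambda>q. (y q - C) \<bullet> (H *v (y q - C))) \<longlonglongrightarrow> t"
  shows "(\<lambda>q. infdist (y q) (ellipse C H t)) \<longlonglongrightarrow> 0"
proof -
  obtain c where c: "0 < c" "\<And>x. c * (norm x)\<^sup>2 \<le> x \<bullet> (H *v x)"
    using sym_posdef_coercive[OF H] by blast
  define a where "a q = (y q - C) \<bullet> (H *v (y q - C))" for q
  have a: "a \<longlonglongrightarrow> t" using lim by (simp add: a_def[abs_def])
  have "\<forall>\<^sub>F q in sequentially. norm (infdist (y q) (ellipse C H t)) \<le> \<bar>1 - sqrt (t / a q)\<bar> * sqrt (a q / c)"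
    using order_tendstoD(1)[OF a t]
  proof eventually_elim
    case (elim q)
    let ?k = "sqrt (t / a q)"
    have k2: "?k\<^sup>2 = t / a q" using elim t by simp
    have "C + ?k *\<^sub>R (y q - C) \<in> ellipse C H t"
      unfolding ellipse_def mem_Collect_eq add_diff_cancel_left' quadratic_form_scaleR k2 a_def[symmetric]
      using elim by simp
    then have "infdist (y q) (ellipse C H t) \<le> dist (y q) (C + ?k *\<^sub>R (y q - C))" by (rule infdist_le)
    also have "\<dots> = norm ((1 - ?k) *\<^sub>R (y q - C))"
      unfolding dist_norm by (simp add: scaleR_left_diff_distrib diff_diff_eq)
    also have "\<dots> = \<bar>1 - ?k\<bar> * norm (y q - C)" by simp
    also have "norm (y q - C) \<le> sqrt (a q / c)"
      using c(2)[of "y q - C"] c(1) by (intro real_le_rsqrt) (simp add: a_def field_simps)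
    finally show ?case by (simp add: infdist_nonneg mult_left_mono)
  qed
  moreover have "(\<lambda>q. \<bar>1 - sqrt (t / a q)\<bar> * sqrt (a q / c)) \<longlonglongrightarrow> \<bar>1 - sqrt (t / t)\<bar> * sqrt (t / c)"
    using t c(1) by (intro tendsto_intros a) auto
  then have "(\<lambda>q. \<bar>1 - sqrt (t / a q)\<bar> * sqrt (a q / c)) \<longlonglongrightarrow> 0" using t by simp
  ultimately show ?thesis by (rule Lim_null_comparison)
qed

lemma dist_homothety:
  fixes C C' y :: "'a::real_normed_vector"
  shows "0 < k \<Longrightarrow> dist C' (C' + k *\<^sub>R (y - C)) = k * dist C y"
  by (simp add: dist_norm norm_minus_commute)

lemma principal_directions_homothety:
  assumes k: "0 < k"
  shows "principal_directions C' ((\<lambda>y. C' + k *\<^sub>R (y - C)) ` E) = principal_directions C E"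
proof -
  have "k *\<^sub>R z \<in> span {u} \<longleftrightarrow> z \<in> span {u}" for z u :: "real^2"
    using k span_scale[of z "{u}" k] span_scale[of "k *\<^sub>R z" "{u}" "1 / k"] by auto
  then show ?thesis
    unfolding principal_directions_def
    by (simp add: dist_homothety k)
qed

text \<open>Supplies what suprema and infima of reals need in \<open>axis_ratio_homothety\<close>;
  the upper bound comes from coercivity.\<close>

lemma ellipse_nonempty_bounded:
  assumes H: "sym_posdef H" and t: "0 < t"
  shows "ellipse C H t \<noteq> {}" and "bdd_above (dist C ` ellipse C H t)"
proof -
  obtain c where c: "0 < c" "\<And>x. c * (norm x)\<^sup>2 \<le> x \<bullet> (H *v x)"
    using sym_posdef_coercive[OF H] by blast
  define e :: "real^2" where "e = axis 1 1"
  have "e \<noteq> 0" by (simp add: e_def axis_eq_0_iff)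
  then have e: "0 < e \<bullet> (H *v e)" using H by (simp add: sym_posdef_def)
  then have "(sqrt (t / (e \<bullet> (H *v e))))\<^sup>2 = t / (e \<bullet> (H *v e))" using t by simp
  then have "C + sqrt (t / (e \<bullet> (H *v e))) *\<^sub>R e \<in> ellipse C H t"
    unfolding ellipse_def mem_Collect_eq add_diff_cancel_left' quadratic_form_scaleR
    using e by simp
  then show "ellipse C H t \<noteq> {}" by blast
  have "dist C y \<le> sqrt (t / c)" if "y \<in> ellipse C H t" for y
    using c(2)[of "y - C"] c(1) that
    by (intro real_le_rsqrt) (simp add: ellipse_def dist_norm norm_minus_commute[of C] field_simps)
  then show "bdd_above (dist C ` ellipse C H t)" by (rule bdd_aboveI2)
qed

lemma axis_ratio_homothety:
  assumes k: "0 < k" and E: "E \<noteq> {}" "bdd_above (dist C ` E)"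
  shows "axis_ratio C' ((\<lambda>y. C' + k *\<^sub>R (y - C)) ` E) = axis_ratio C E"
proof -
  have mono: "mono (\<lambda>x. k * x)" using k by (auto intro!: monoI mult_left_mono)
  have below: "bdd_below (dist C ` E)" by (rule bdd_belowI2[of _ 0]) simp
  have ne: "dist C ` E \<noteq> {}" using E(1) by simp
  have "(SUP y\<in>(\<lambda>y. C' + k *\<^sub>R (y - C)) ` E. dist C' y) = (SUP d\<in>dist C ` E. k * d)"
    unfolding image_image dist_homothety[OF k] ..
  also have "\<dots> = k * (SUP y\<in>E. dist C y)"
    by (rule continuous_at_Sup_mono[OF mono _ ne E(2), symmetric]) (intro continuous_intros)
  finally have sup: "(SUP y\<in>(\<lambda>y. C' + k *\<^sub>R (y - C)) ` E. dist C' y) = k * (SUP y\<in>E. dist C y)" .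
  have "(INF y\<in>(\<lambda>y. C' + k *\<^sub>R (y - C)) ` E. dist C' y) = (INF d\<in>dist C ` E. k * d)"
    unfolding image_image dist_homothety[OF k] ..
  also have "\<dots> = k * (INF y\<in>E. dist C y)"
    by (rule continuous_at_Inf_mono[OF mono _ ne below, symmetric]) (intro continuous_intros)
  finally have inf: "(INF y\<in>(\<lambda>y. C' + k *\<^sub>R (y - C)) ` E. dist C' y) = k * (INF y\<in>E. dist C y)" .
  show ?thesis unfolding axis_ratio_def sup inf using k by simp
qed

lemma setwise_tendsto_finite_image:
  assumes "finite I" "\<And>i. i \<in> I \<Longrightarrow> (\<lambda>q. f q i) \<longlonglongrightarrow> g i"
  shows "setwise_tendsto (\<lambda>q. f q ` I) (g ` I)"
  unfolding setwise_tendsto_def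
proof (intro allI impI)
  fix \<epsilon> :: real assume "\<epsilon> > 0"
  then have "\<forall>\<^sub>F q in sequentially. \<forall>i\<in>I. dist (f q i) (g i) < \<epsilon>"
    using assms by (intro eventually_ball_finite) (auto dest: tendstoD)
  then show "\<forall>\<^sub>F q in sequentially. (\<forall>x\<in>f q ` I. \<exists>y\<in>g ` I. dist x y < \<epsilon>) \<and> (\<forall>y\<in>g ` I. \<exists>x\<in>f q ` I. dist x y < \<epsilon>)"
    by eventually_elim blast
qed

subsection \<open>Iterates of an elliptic projectivity\<close>

lemma invariant_form_funpow:
  fixes H M :: "real^2^2"
  assumes "transpose M ** H ** M = \<kappa> *\<^sub>R H"
  shows "((*v) M ^^ q) x \<bullet> (H *v ((*v) M ^^ q) x) = \<kappa> ^ q * (x \<bullet> (H *v x))"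
proof (induction q)
  case (Suc q)
  have "(M *v y) \<bullet> (H *v (M *v y)) = \<kappa> * (y \<bullet> (H *v y))" for y
  proof -
    have "(M *v y) \<bullet> (H *v (M *v y)) = y \<bullet> ((transpose M ** H ** M) *v y)"
      by (metis dot_lmul_matrix matrix_vector_mul_assoc vector_transpose_matrix transpose_transpose)
    then show ?thesis by (simp add: assms flip: scaleR_matrix_vector_assoc)
  qed
  then show ?case by (simp add: Suc.IH)
qed simp

lemma linear_funpow_matrix: "linear ((*v) (M :: real^'n^'n) ^^ q)"
proof (induction q)
  case 0
  show ?case by (auto intro: linearI)
next
  case (Suc q)
  have "((*v) M ^^ Suc q) = (*v) M \<circ> ((*v) M ^^ q)" by simp
  then show ?case using Suc.IH by (metis linear_compose matrix_vector_mul_linear)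
qed

text \<open>The quotient rule leaves the term -(c . h) (A X + b) / (c . X + d)^2; at a fixed point
  (A X + b) / (c . X + d) is \<open>X\<close>, which turns it into the rank-one correction.\<close>

lemma has_derivative_fractional:
  fixes A :: "real^2^2" and b c X :: "real^2"
  assumes d: "c \<bullet> X + d \<noteq> 0" and fp: "(1 / (c \<bullet> X + d)) *\<^sub>R (A *v X + b) = X"
  shows "((\<lambda>x. (1 / (c \<bullet> x + d)) *\<^sub>R (A *v x + b)) has_derivative
    (\<lambda>h. ((1 / (c \<bullet> X + d)) *\<^sub>R (A - (\<chi> i j. X $ i * c $ j))) *v h)) (at X)"
proof -
  have "((\<lambda>x. A *v x) has_derivative (\<lambda>h. A *v h)) (at X)"
    by (simp add: bounded_linear_imp_has_derivative)
  then have "((\<lambda>x. (1 / (c \<bullet> x + d)) *\<^sub>R (A *v x + b)) has_derivative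
      (\<lambda>h. (1 / (c \<bullet> X + d)) *\<^sub>R (A *v h) + (- (c \<bullet> h) / (c \<bullet> X + d)\<^sup>2) *\<^sub>R (A *v X + b))) (at X)"
    using d by (auto intro!: derivative_eq_intros simp: power2_eq_square divide_inverse)
  moreover have "(1 / (c \<bullet> X + d)) *\<^sub>R (A *v h) + (- (c \<bullet> h) / (c \<bullet> X + d)\<^sup>2) *\<^sub>R (A *v X + b)
      = ((1 / (c \<bullet> X + d)) *\<^sub>R (A - (\<chi> i j. X $ i * c $ j))) *v h" for h
  proof -
    have "(- (c \<bullet> h) / (c \<bullet> X + d)\<^sup>2) *\<^sub>R (A *v X + b)
        = (1 / (c \<bullet> X + d)) *\<^sub>R (- (c \<bullet> h)) *\<^sub>R ((1 / (c \<bullet> X + d)) *\<^sub>R (A *v X + b))"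
      by (simp add: power2_eq_square)
    also have "\<dots> = (1 / (c \<bullet> X + d)) *\<^sub>R (- (c \<bullet> h)) *\<^sub>R X" unfolding fp ..
    finally have e1: "(- (c \<bullet> h) / (c \<bullet> X + d)\<^sup>2) *\<^sub>R (A *v X + b) =
        (1 / (c \<bullet> X + d)) *\<^sub>R (- (c \<bullet> h)) *\<^sub>R X" .
    have e2: "(\<chi> i j. X $ i * c $ j) *v h = (c \<bullet> h) *\<^sub>R X"
      by (simp add: vec_eq_iff matrix_vector_mult_def inner_vec_def sum_2 algebra_simps)
    show ?thesis
      unfolding e1 scaleR_matrix_vector_assoc[symmetric] matrix_vector_mult_diff_rdistrib e2
      by (simp add: scaleR_right_diff_distrib)
  qed
  ultimately show ?thesis by simp
qed

lemma jacobian_eqI: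
  assumes "(f has_derivative (\<lambda>h. K *v h)) (at (x :: real^'n))"
  shows "jacobian f (at x) = K"
  unfolding jacobian_def frechet_derivative_at[OF assms, symmetric] by (rule matrix_of_matrix_vector_mul)

text \<open>Since z and cnj z differ, the sum of their eigenspaces is the kernel of (N - z)(N - cnj
  z). This polynomial in \<open>N\<close> has real coefficients, so membership becomes a real vector
  equation.\<close>

lemma real_invariant_space_iff:
  fixes N :: "real^'n^'n"
  assumes z: "Im z \<noteq> 0"
  shows "x \<in> real_invariant_space N z \<longleftrightarrow>
    N *v (N *v x) = (2 * Re z) *\<^sub>R (N *v x) - (cmod z)\<^sup>2 *\<^sub>R x"
proof
  have tr: "complex_of_real (2 * Re z) = z + cnj z" and nm: "complex_of_real ((cmod z)\<^sup>2) = z * cnj z"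
    by (simp_all only: complex_add_cnj complex_norm_square)
  have cN: "cmat N *v cvec y = cvec (N *v y)" for y
    by (simp add: vec_eq_iff cmat_def cvec_def matrix_vector_mult_def)
  {
    assume "x \<in> real_invariant_space N z"
    then obtain u w where u: "cmat N *v u = z *s u" and w: "cmat N *v w = cnj z *s w" and x: "cvec x = u + w"
      by (auto simp: real_invariant_space_def)
    have 1: "cvec (N *v x) = z *s u + cnj z *s w"
      by (simp add: x matrix_vector_right_distrib u w flip: cN)
    then have 2: "cvec (N *v (N *v x)) = z *s (z *s u) + cnj z *s (cnj z *s w)"
      by (simp add: matrix_vector_right_distrib vector_scalar_commute u w flip: cN)
    show "N *v (N *v x) = (2 * Re z) *\<^sub>R (N *v x) - (cmod z)\<^sup>2 *\<^sub>R x"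
    proof (rule vec_eq_iff[THEN iffD2], rule allI)
      fix i
      have "complex_of_real ((N *v (N *v x)) $ i) = z * (z * u$i) + cnj z * (cnj z * w$i)"
        using arg_cong[OF 2, of "\<lambda>y. y $ i"] by (simp add: cvec_def)
      also have "\<dots> = (z + cnj z) * (z * u$i + cnj z * w$i) - (z * cnj z) * (u$i + w$i)"
        by (simp add: algebra_simps)
      also have "z * u$i + cnj z * w$i = complex_of_real ((N *v x) $ i)"
        using arg_cong[OF 1, of "\<lambda>y. y $ i"] by (simp add: cvec_def)
      also have "u$i + w$i = complex_of_real (x $ i)"
        using arg_cong[OF x, of "\<lambda>y. y $ i"] by (simp add: cvec_def)
      finally have "complex_of_real ((N *v (N *v x)) $ i) =
          complex_of_real ((2 * Re z) * (N *v x) $ i - (cmod z)\<^sup>2 * x $ i)"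
        unfolding of_real_diff of_real_mult[of _ "(N *v x) $ i"] of_real_mult[of _ "x $ i"] tr nm .
      then show "(N *v (N *v x)) $ i = ((2 * Re z) *\<^sub>R (N *v x) - (cmod z)\<^sup>2 *\<^sub>R x) $ i"
        unfolding of_real_eq_iff by simp
    qed
  }
  {
    assume NN: "N *v (N *v x) = (2 * Re z) *\<^sub>R (N *v x) - (cmod z)\<^sup>2 *\<^sub>R x"
    define y where "y = N *v x"
    define e where "e = inverse (z - cnj z)"
    have "z - cnj z \<noteq> 0" using z by (auto simp: complex_eq_iff)
    then have e: "e * (z - cnj z) = 1" by (simp add: e_def)
    have cy: "cvec (N *v y) = (z + cnj z) *s cvec y - (z * cnj z) *s cvec x"
      unfolding y_def NN
      unfolding tr[symmetric] nm[symmetric] by (simp add: vec_eq_iff cvec_def)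
    \<comment> \<open>The components of \<open>x\<close> under the two spectral projections (N - cnj
      z) / (z - cnj z) and (N - z) / (cnj z - z).\<close>
    define u where "u = e *s (cvec y - cnj z *s cvec x)"
    define w where "w = (- e) *s (cvec y - z *s cvec x)"
    have Nu: "cmat N *v (e *s (cvec y - t *s cvec x)) = e *s (cvec (N *v y) - t *s cvec y)" for e t
      unfolding y_def by (simp only: vector_scalar_commute matrix_vector_mult_diff_distrib cN)
    have "cmat N *v u = z *s u"
      unfolding u_def Nu cy by (simp add: vec_eq_iff algebra_simps)
    moreover have "cmat N *v w = cnj z *s w"
      unfolding w_def Nu cy by (simp add: vec_eq_iff algebra_simps)
    moreover have "cvec x = u + w"
    proof (rule vec_eq_iff[THEN iffD2], rule allI)
      fix i
      have "(u + w) $ i = e * (z - cnj z) * cvec x $ i" by (simp add: u_def w_def algebra_simps)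
      then show "cvec x $ i = (u + w) $ i" by (simp add: e)
    qed
    ultimately show "x \<in> real_invariant_space N z" unfolding real_invariant_space_def by blast
  }
qed

text \<open>Coordinates on \<open>\<real>\<^sup>3\<close> along \<open>X\<close>: a vector \<open>h\<close> equals \<open>h\<^sub>3\<close> times the lift of \<open>X\<close> plus the
  horizontal vector \<open>offset X h\<close>.\<close>

definition offset :: "real^2 \<Rightarrow> real^3 \<Rightarrow> real^2" where
  "offset X h = vector [h$1 - h$3 * X$1, h$2 - h$3 * X$2]"

lemma offset_nth [simp]: "offset X h $ 1 = h$1 - h$3 * X$1" "offset X h $ 2 = h$2 - h$3 * X$2"
  by (simp_all add: offset_def)

lemma offset_homog [simp]: "offset X (homog x) = x - X"
  by (simp add: vec_eq_iff forall_2)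

lemma dehomog_offset: "h$3 \<noteq> 0 \<Longrightarrow> dehomog h = X + (1 / h$3) *\<^sub>R offset X h"
  by (simp add: vec_eq_iff forall_2 diff_divide_distrib)

text \<open>One coordinate of the action of \<open>N\<close> modulo the lift of \<open>X\<close>:
  the n's are the row in question, the m's the third row. Stated over any field because it is
  applied both to real vectors and to a complex eigenvector.\<close>

lemma fractional_row:
  fixes l :: "'a::field"
  assumes "n1 * x1 + n2 * x2 + n3 = l * x" "m1 * x1 + m2 * x2 + m3 = l" "l \<noteq> 0"
  shows "(n1 * h1 + n2 * h2 + n3 * h3) - (m1 * h1 + m2 * h2 + m3 * h3) * x =
    l * ((n1 - x * m1) / l * (h1 - h3 * x1) + (n2 - x * m2) / l * (h2 - h3 * x2))"
proof -
  have n3: "n3 = l * x - (n1 * x1 + n2 * x2)" and m3: "m3 = l - (m1 * x1 + m2 * x2)"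
    using assms by (auto simp: algebra_simps)
  have cancel: "l * ((n1 - x * m1) / l * (h1 - h3 * x1) + (n2 - x * m2) / l * (h2 - h3 * x2))
      = (n1 - x * m1) * (h1 - h3 * x1) + (n2 - x * m2) * (h2 - h3 * x2)"
    using assms(3) by (simp add: distrib_left)
  show ?thesis unfolding cancel n3 m3 by (simp add: algebra_simps)
qed

locale elliptic_projectivity =
  fixes G :: "rp2 \<Rightarrow> rp2" and N :: "real^3^3" and lam \<rho> \<theta> :: real and v :: "real^3"
    and X :: "real^2" and \<tau> \<phi> :: real
  assumes spec: "elliptic_spectrum G N lam \<rho> \<theta> v X \<tau> \<phi>"
begin

abbreviation M :: "real^2^2" where "M \<equiv> linearization G X"

definition row3 :: "real^2" where "row3 = vector [N$3$1, N$3$2]"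

lemma N_inv: "invertible N" and G_eq: "G = projectivity N"
  and \<rho>_pos: "0 < \<rho>" and \<rho>_less: "\<rho> < \<bar>lam\<bar>" and \<tau>_eq: "\<tau> = \<rho> / \<bar>lam\<bar>"
  and sin_pos: "0 < sin \<theta>"
  and ev_N: "eigenvalues N = {complex_of_real lam, \<rho> * cis \<theta>, \<rho> * cis (- \<theta>)}"
  and mu_eq: "\<rho> * cis \<theta> / lam = \<tau> * cis \<phi>"
  using spec sin_gt_zero[of \<theta>] by (auto simp: elliptic_spectrum_def)

lemma lam_nonzero: "lam \<noteq> 0" and \<tau>_pos: "0 < \<tau>" and \<tau>_less_1: "\<tau> < 1"
  using \<rho>_pos \<rho>_less by (auto simp: \<tau>_eq)

lemma v_homog: obtains k where "k \<noteq> 0" "v = k *\<^sub>R homog X"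
proof -
  have v: "v \<noteq> 0" "chart_embed X = hpoint v"
    using spec by (simp_all add: elliptic_spectrum_def)
  then show ?thesis using that by (metis chart_embed_homog homog_nonzero hpoint_eqD)
qed

lemma N_homog_X: "N *v homog X = lam *\<^sub>R homog X"
proof -
  obtain k where k: "k \<noteq> 0" "v = k *\<^sub>R homog X" by (rule v_homog)
  have "N *v v = lam *\<^sub>R v" using spec by (simp add: elliptic_spectrum_def)
  then have "k *\<^sub>R (N *v homog X) = k *\<^sub>R (lam *\<^sub>R homog X)"
    by (simp add: k(2) matrix_vector_mult_scaleR scaleR_left_commute)
  with k(1) show ?thesis by (metis scaleR_cancel_left)
qed

lemma N_homog_X_nth:
  "N$1$1 * X$1 + N$1$2 * X$2 + N$1$3 = lam * X$1"
  "N$2$1 * X$1 + N$2$2 * X$2 + N$2$3 = lam * X$2"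
  "N$3$1 * X$1 + N$3$2 * X$2 + N$3$3 = lam"
  using arg_cong[OF N_homog_X, of "\<lambda>h. h$1"] arg_cong[OF N_homog_X, of "\<lambda>h. h$2"]
    arg_cong[OF N_homog_X, of "\<lambda>h. h$3"]
  by (simp_all add: matrix_vector_mult_def sum_3)

lemma affine_map_G:
  assumes "(N *v homog x) $ 3 \<noteq> 0"
  shows "affine_map G x = dehomog (N *v homog x)"
  using assms by (simp add: affine_map_def chart_embed_homog G_eq projectivity_hpoint affine_point_hpoint)

lemma G_in_chart: "(N *v homog x) $ 3 \<noteq> 0 \<Longrightarrow> G (chart_embed x) \<in> range chart_embed"
  unfolding G_eq chart_embed_homog[of x] projectivity_hpoint[OF homog_nonzero]
  by (simp add: hpoint_dehomog)

lemma affine_map_fixed: "affine_map G X = X"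
  using lam_nonzero by (simp add: affine_map_G N_homog_X vec_eq_iff forall_2)

lemma eventually_in_chart: "\<forall>\<^sub>F x in nhds X. (N *v homog x) $ 3 \<noteq> 0"
proof -
  have "isCont (\<lambda>x. (N *v homog x) $ 3) X"
    unfolding matrix_vector_mult_def by (simp add: sum_3)
  moreover have "(N *v homog X) $ 3 \<noteq> 0" by (simp add: N_homog_X lam_nonzero)
  ultimately show ?thesis
    by (simp add: isCont_def eventually_nhds_conv_at tendsto_imp_eventually_ne)
qed

text \<open>The fractional form is given only where \<open>G\<close> stays in the chart. Such points
  fill a neighbourhood of \<open>X\<close>, which is enough for the derivative.\<close>

lemma fractional_has_derivative:
  assumes c: "\<And>x. G (chart_embed x) \<in> range chart_embed \<Longrightarrow>
        c \<bullet> x + d \<noteq> 0 \<and> affine_map G x = (1 / (c \<bullet> x + d)) *\<^sub>R (A *v x + b)"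
  shows "(affine_map G has_derivative
      (\<lambda>h. ((1 / (c \<bullet> X + d)) *\<^sub>R (A - (\<chi> i j. X $ i * c $ j))) *v h)) (at X)"
proof -
  have cX: "c \<bullet> X + d \<noteq> 0" "(1 / (c \<bullet> X + d)) *\<^sub>R (A *v X + b) = X"
    using c[of X] G_in_chart[of X] by (simp_all add: affine_map_fixed N_homog_X lam_nonzero)
  have ev: "\<forall>\<^sub>F x in at X. (1 / (c \<bullet> x + d)) *\<^sub>R (A *v x + b) = affine_map G x"
    using eventually_in_chart unfolding eventually_at_filter
    by (rule eventually_mono) (use c G_in_chart in auto)
  show ?thesis
    by (rule has_derivative_transform_eventually[OF has_derivative_fractional[OF cX] ev])
      (simp_all add: cX affine_map_fixed)
qed

lemma linearization_eq:
  assumes c: "\<And>x. G (chart_embed x) \<in> range chart_embed \<Longrightarrow>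
        c \<bullet> x + d \<noteq> 0 \<and> affine_map G x = (1 / (c \<bullet> x + d)) *\<^sub>R (A *v x + b)"
  shows "M = (1 / (c \<bullet> X + d)) *\<^sub>R (A - (\<chi> i j. X $ i * c $ j))"
  unfolding linearization_def by (rule jacobian_eqI[OF fractional_has_derivative[OF c]])

lemma in_chartD:
  assumes "G (chart_embed x) \<in> range chart_embed"
  shows "(N *v homog x) $ 3 \<noteq> 0"
proof -
  obtain y where "hpoint (homog y) = hpoint (N *v homog x)"
    using assms by (auto simp: chart_embed_homog G_eq projectivity_hpoint)
  then obtain k where "k \<noteq> 0" "N *v homog x = k *\<^sub>R homog y"
    by (rule hpoint_eqD) (simp_all add: N_inv invertible_mult_nonzero)
  then show ?thesis by simp
qed

text \<open>Any fractional form of \<open>G\<close> yields the same linearization; the blocks of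
  \<open>N\<close> provide one with known entries.\<close>

lemma M_nth:
  "M $ 1 $ 1 = (N$1$1 - X$1 * N$3$1) / lam" "M $ 1 $ 2 = (N$1$2 - X$1 * N$3$2) / lam"
  "M $ 2 $ 1 = (N$2$1 - X$2 * N$3$1) / lam" "M $ 2 $ 2 = (N$2$2 - X$2 * N$3$2) / lam"
proof -
  let ?A = "vector [vector [N$1$1, N$1$2], vector [N$2$1, N$2$2]] :: real^2^2"
  have third: "row3 \<bullet> x + N$3$3 = (N *v homog x) $ 3" for x
    by (simp add: row3_def inner_vec_def sum_2 matrix_vector_mult_def sum_3)
  have *: "row3 \<bullet> x + N$3$3 \<noteq> 0 \<and> affine_map G x = (1 / (row3 \<bullet> x + N$3$3)) *\<^sub>R (?A *v x + vector [N$1$3, N$2$3])"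
    if "G (chart_embed x) \<in> range chart_embed" for x
    unfolding third using in_chartD[OF that]
    by (simp add: affine_map_G vec_eq_iff forall_2 matrix_vector_mult_def sum_2 sum_3)
  have lamX: "row3 \<bullet> X + N$3$3 = lam" by (simp add: third N_homog_X)
  have "M = (1 / lam) *\<^sub>R (?A - (\<chi> i j. X $ i * row3 $ j))"
    using linearization_eq[of row3 "N$3$3" ?A "vector [N$1$3, N$2$3]", OF *] unfolding lamX .
  then have "M $ i $ j = (?A $ i $ j - X $ i * row3 $ j) / lam" for i j
    by simp
  then show "M $ 1 $ 1 = (N$1$1 - X$1 * N$3$1) / lam" "M $ 1 $ 2 = (N$1$2 - X$1 * N$3$2) / lam"
    "M $ 2 $ 1 = (N$2$1 - X$2 * N$3$1) / lam" "M $ 2 $ 2 = (N$2$2 - X$2 * N$3$2) / lam"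
    unfolding row3_def by simp_all
qed

lemma offset_N: "offset X (N *v h) = lam *\<^sub>R (M *v offset X h)"
proof -
  have "offset X (N *v h) $ 1 = (lam *\<^sub>R (M *v offset X h)) $ 1"
    using fractional_row[OF N_homog_X_nth(1,3) lam_nonzero, of "h$1" "h$2" "h$3"]
    by (simp only: matrix_vector_mult_def sum_2 sum_3 M_nth offset_nth vec_lambda_beta
        vector_scaleR_component real_scaleR_def)
  moreover have "offset X (N *v h) $ 2 = (lam *\<^sub>R (M *v offset X h)) $ 2"
    using fractional_row[OF N_homog_X_nth(2,3) lam_nonzero, of "h$1" "h$2" "h$3"]
    by (simp only: matrix_vector_mult_def sum_2 sum_3 M_nth offset_nth vec_lambda_beta
        vector_scaleR_component real_scaleR_def)
  ultimately show ?thesis by (simp add: vec_eq_iff forall_2)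
qed

lemma third_N: "(N *v h) $ 3 = lam * h$3 + row3 \<bullet> offset X h"
proof -
  have N33: "N$3$3 = lam - (N$3$1 * X$1 + N$3$2 * X$2)" using N_homog_X_nth(3) by simp
  show ?thesis
    unfolding matrix_vector_mult_def sum_3 row3_def inner_vec_def sum_2 vec_lambda_beta vector_2
      offset_nth inner_real_def N33
    by (simp only: left_diff_distrib right_diff_distrib distrib_right mult.assoc mult.left_commute) simp
qed

definition \<mu> :: complex where "\<mu> = \<tau> * cis \<phi>"

lemma z_eq: "\<rho> * cis \<theta> = lam * \<mu>"
proof -
  have "complex_of_real lam \<noteq> 0" using lam_nonzero by simp
  then show ?thesis
    using mu_eq unfolding \<mu>_def by (metis nonzero_divide_eq_eq mult.commute)
qed

lemma Im_\<mu>: "Im \<mu> \<noteq> 0"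
proof
  assume "Im \<mu> = 0"
  then have "Im (\<rho> * cis \<theta>) = 0" unfolding z_eq by simp
  then show False using \<rho>_pos sin_pos by simp
qed

lemma cmod_\<mu>: "cmod \<mu> = \<tau>"
  using \<tau>_pos by (simp add: \<mu>_def norm_mult)

text \<open>An eigenvector of \<open>N\<close> for z = lam \<mu> projects modulo the lift of
  \<open>X\<close> to a vector \<open>p\<close> with M p = \<mu> p. If \<open>p\<close> were zero,
  the eigenvector would be a multiple of that lift, forcing the non-real z to equal lam.\<close>

lemma \<mu>_eigenvalue: "\<mu> \<in> eigenvalues M"
proof -
  define z where "z = \<rho> * cis \<theta>"
  have "z \<in> eigenvalues N" using ev_N by (simp add: z_def)
  then obtain u where u: "u \<noteq> 0" "cmat N *v u = z *s u" by (auto simp: eigenvalues_def)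
  have un: "of_real (N$1$1) * u$1 + of_real (N$1$2) * u$2 + of_real (N$1$3) * u$3 = z * u$1"
      "of_real (N$2$1) * u$1 + of_real (N$2$2) * u$2 + of_real (N$2$3) * u$3 = z * u$2"
      "of_real (N$3$1) * u$1 + of_real (N$3$2) * u$2 + of_real (N$3$3) * u$3 = z * u$3"
    using arg_cong[OF u(2), of "\<lambda>h. h$1"] arg_cong[OF u(2), of "\<lambda>h. h$2"] arg_cong[OF u(2), of "\<lambda>h. h$3"]
    by (simp_all add: matrix_vector_mult_def sum_3 cmat_def)
  note cX = N_homog_X_nth[THEN arg_cong[of _ _ complex_of_real], unfolded of_real_add of_real_mult]
  have lam0: "complex_of_real lam \<noteq> 0" using lam_nonzero by simp
  define p :: "complex^2" where "p = vector [u$1 - u$3 * X$1, u$2 - u$3 * X$2]"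
  have "lam * ((cmat M *v p) $ 1) = z * u$1 - z * u$3 * X$1"
    using fractional_row[OF cX(1,3) lam0, of "u$1" "u$2" "u$3"] unfolding un
    by (simp add: matrix_vector_mult_def sum_2 cmat_def M_nth p_def)
  also have "\<dots> = lam * (\<mu> * p $ 1)"
    unfolding z_eq z_def by (simp add: p_def algebra_simps)
  finally have 1: "(cmat M *v p) $ 1 = \<mu> * p $ 1" using lam0 by (simp only: mult_cancel_left simp_thms)
  have "lam * ((cmat M *v p) $ 2) = z * u$2 - z * u$3 * X$2"
    using fractional_row[OF cX(2,3) lam0, of "u$1" "u$2" "u$3"] unfolding un
    by (simp add: matrix_vector_mult_def sum_2 cmat_def M_nth p_def)
  also have "\<dots> = lam * (\<mu> * p $ 2)"
    unfolding z_eq z_def by (simp add: p_def algebra_simps)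
  finally have 2: "(cmat M *v p) $ 2 = \<mu> * p $ 2" using lam0 by (simp only: mult_cancel_left simp_thms)
  have "cmat M *v p = \<mu> *s p"
    unfolding vec_eq_iff forall_2 vector_smult_component using 1 2 by (rule conjI)
  moreover have "p \<noteq> 0"
  proof
    assume "p = 0"
    then have p0: "u$1 = u$3 * X$1" "u$2 = u$3 * X$2"
      by (simp_all add: p_def vec_eq_iff forall_2)
    then have "u$3 \<noteq> 0" using u(1) by (auto simp: vec_eq_iff forall_3)
    moreover have "u$3 * lam = of_real (N$3$1) * (u$3 * X$1) + of_real (N$3$2) * (u$3 * X$2) + of_real (N$3$3) * u$3"
      unfolding cX(3)[symmetric] by (simp add: algebra_simps)
    then have "u$3 * lam = z * u$3"
      using un(3) unfolding p0 by (rule trans)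
    ultimately have "z = lam" by simp
    then have "Im z = 0" by simp
    then show False using \<rho>_pos sin_pos by (simp add: z_def)
  qed
  ultimately show ?thesis unfolding eigenvalues_def mem_Collect_eq by (intro exI[of _ p] conjI)
qed

lemmas trace_M = nonreal_eigenvalue_2(1)[OF \<mu>_eigenvalue Im_\<mu>]
  and det_M = nonreal_eigenvalue_2(2)[OF \<mu>_eigenvalue Im_\<mu>, unfolded cmod_\<mu>]
  and eigenvalues_M = nonreal_eigenvalue_2(3)[OF \<mu>_eigenvalue Im_\<mu>]
  and disc_M = nonreal_eigenvalue_discriminant[OF \<mu>_eigenvalue Im_\<mu>]

text \<open>The characteristic polynomial of \<open>M\<close> at 1; it has no real root, hence is
  positive.\<close>

lemma one_minus_trace_M: "0 < 1 - trace M + det M"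
proof -
  have "(2 - trace M)\<^sup>2 = 4 - 4 * trace M + (trace M)\<^sup>2"
    by (simp add: power2_eq_square algebra_simps)
  then show ?thesis
    using disc_M zero_le_power2[of "2 - trace M"] by linarith
qed

text \<open>The covector \<open>kvec\<close> makes \<open>ell\<close> the left eigenvector of \<open>N\<close> for the dominant eigenvalue,
  normalized to take the value 1 at the lift of \<open>X\<close>.\<close>

definition kvec :: "real^2" where
  "kvec = (SOME k. \<forall>p. k \<bullet> (M *v p) = k \<bullet> p - row3 \<bullet> p / lam)"

lemma kvec: "kvec \<bullet> (M *v p) = kvec \<bullet> p - row3 \<bullet> p / lam"
proof -
  have det: "det (mat 1 - M) = 1 - trace M + det M"
    by (simp add: det_2 trace_def sum_2 mat_def algebra_simps)
  \<comment> \<open>As row vectors the required identity reads k (1 - M) = row3 / lam, so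
    \<open>k\<close> is the right side times the inverse \<open>B\<close>.\<close>
  have "invertible (mat 1 - M)" unfolding invertible_det_nz det using one_minus_trace_M by linarith
  then obtain B where B: "B ** (mat 1 - M) = mat 1" unfolding invertible_def by blast
  have "(((1 / lam) *\<^sub>R row3) v* B) \<bullet> (M *v p) = (((1 / lam) *\<^sub>R row3) v* B) \<bullet> p - row3 \<bullet> p / lam" for p
  proof -
    have "(((1 / lam) *\<^sub>R row3) v* B) \<bullet> ((mat 1 - M) *v p) = ((1 / lam) *\<^sub>R row3) \<bullet> p"
      by (simp add: dot_lmul_matrix matrix_vector_mul_assoc B)
    then show ?thesis by (simp add: matrix_vector_mult_diff_rdistrib inner_diff_right)
  qed
  then have "\<exists>k. \<forall>p. k \<bullet> (M *v p) = k \<bullet> p - row3 \<bullet> p / lam" by blast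
  then show ?thesis unfolding kvec_def by (rule someI2_ex) blast
qed

definition ell :: "real^3 \<Rightarrow> real" where "ell h = h$3 + kvec \<bullet> offset X h"

lemma ell_N: "ell (N *v h) = lam * ell h"
  using lam_nonzero by (simp add: ell_def third_N offset_N kvec algebra_simps)

lemma linear_offset: "linear (offset X)"
  by (rule linearI) (simp_all add: vec_eq_iff forall_2 algebra_simps)

lemma linear_ell: "linear ell"
  by (rule linearI) (simp_all add: ell_def linear_add[OF linear_offset] linear_scale[OF linear_offset] algebra_simps)

text \<open>\<open>offset X\<close> and \<open>ell\<close> together are linear coordinates on
  3-space, in which \<open>N\<close> acts block-diagonally, by lam M and by lam.\<close>

lemma offset_ell_eq_0: "offset X h = 0 \<Longrightarrow> ell h = 0 \<Longrightarrow> h = 0"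
proof -
  assume *: "offset X h = 0" "ell h = 0"
  then have "h$3 = 0" by (simp add: ell_def)
  moreover have "h$1 - h$3 * X$1 = 0" "h$2 - h$3 * X$2 = 0"
    using arg_cong[OF *(1), of "\<lambda>p. p$1"] arg_cong[OF *(1), of "\<lambda>p. p$2"] by simp_all
  ultimately show "h = 0" by (simp add: vec_eq_iff forall_3)
qed

lemma third_eq: "h$3 = ell h - kvec \<bullet> offset X h"
  by (simp add: ell_def)

lemma ell_homog_X [simp]: "ell (homog X) = 1"
  by (simp add: ell_def)

lemma cayley_hamilton_M: "M *v (M *v p) = trace M *\<^sub>R (M *v p) - det M *\<^sub>R p"
  by (simp add: vec_eq_iff forall_2 matrix_vector_mult_def sum_2 trace_def det_2 algebra_simps)

text \<open>The quadratic defining the invariant space is lam^2 times the characteristic polynomial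
  of \<open>M\<close>, evaluated at \<open>N / lam\<close>. Cayley-Hamilton makes it vanish on the
  \<open>offset\<close> coordinate; on \<open>ell\<close> it multiplies by lam^2 (1 - tr M + det M),
  which is nonzero.\<close>

lemma invariant_space_eq: "h \<in> real_invariant_space N (\<rho> * cis \<theta>) \<longleftrightarrow> ell h = 0"
proof -
  let ?z = "\<rho> * cis \<theta>"
  have Imz: "Im ?z \<noteq> 0" using \<rho>_pos sin_pos by simp
  have tr: "2 * Re ?z = lam * trace M" unfolding z_eq trace_M by simp
  have nm: "(cmod ?z)\<^sup>2 = lam\<^sup>2 * det M" unfolding z_eq det_M
    by (simp add: norm_mult cmod_\<mu> power_mult_distrib)
  define y where "y = N *v (N *v h) - ((lam * trace M) *\<^sub>R (N *v h) - (lam\<^sup>2 * det M) *\<^sub>R h)"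
  have "offset X y = 0"
    unfolding y_def linear_diff[OF linear_offset] linear_scale[OF linear_offset] offset_N
      matrix_vector_mult_scaleR cayley_hamilton_M
    by (simp add: algebra_simps power2_eq_square)
  moreover have "ell y = lam\<^sup>2 * (1 - trace M + det M) * ell h"
    unfolding y_def linear_diff[OF linear_ell] linear_scale[OF linear_ell] ell_N
    by (simp add: algebra_simps power2_eq_square)
  ultimately have "y = 0 \<longleftrightarrow> ell h = 0"
    using offset_ell_eq_0[of y] lam_nonzero one_minus_trace_M linear_0[OF linear_ell] by force
  then show ?thesis
    unfolding real_invariant_space_iff[OF Imz] tr nm y_def by simp
qed

text \<open>If \<open>ell h = 0\<close>, then \<open>h\<close> itself lies in the invariant plane,
  so 0 meets the description of the projection. It is the only such vector because
  \<open>ell\<close> does not vanish at the lift of \<open>X\<close>, hence not on the rest of the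
  line through \<open>v\<close>.\<close>

lemma projection_nonzero_imp:
  assumes "projection_along v (real_invariant_space N (\<rho> * cis \<theta>)) h \<noteq> 0"
  shows "ell h \<noteq> 0"
proof
  assume h0: "ell h = 0"
  have "projection_along v (real_invariant_space N (\<rho> * cis \<theta>)) h = 0"
    unfolding projection_along_def
  proof (rule the_equality)
    show "0 \<in> span {v} \<and> h - 0 \<in> real_invariant_space N (\<rho> * cis \<theta>)"
      using h0 by (simp add: span_zero invariant_space_eq)
  next
    fix y assume y: "y \<in> span {v} \<and> h - y \<in> real_invariant_space N (\<rho> * cis \<theta>)"
    obtain k where "v = k *\<^sub>R homog X" using v_homog by blast
    then obtain t where t: "y = t *\<^sub>R homog X" using y by (auto simp: span_singleton)
    have "ell (h - y) = - t"
      by (simp add: linear_diff[OF linear_ell] t linear_scale[OF linear_ell] h0)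
    then have "t = 0" using y by (simp add: invariant_space_eq)
    then show "y = 0" by (simp add: t)
  qed
  with assms show False by blast
qed

section \<open>Exact iterates, their decay and their leading coefficient\<close>

lemma offset_funpow: "offset X (((*v) N ^^ q) h) = lam ^ q *\<^sub>R ((*v) M ^^ q) (offset X h)"
  by (induction q) (simp_all add: offset_N matrix_vector_mult_scaleR)

lemma ell_funpow: "ell (((*v) N ^^ q) h) = lam ^ q * ell h"
  by (induction q) (simp_all add: ell_N)

text \<open>The last homogeneous coordinate of \<open>(N / lam)\<^sup>q\<close> applied to the lift of \<open>x\<close>.\<close>

definition denom :: "real^2 \<Rightarrow> nat \<Rightarrow> real" where
  "denom x q = ell (homog x) - kvec \<bullet> ((*v) M ^^ q) (x - X)"

lemma third_funpow: "((*v) N ^^ q) (homog x) $ 3 = lam ^ q * denom x q"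
  unfolding third_eq offset_funpow ell_funpow denom_def by (simp add: algebra_simps)

lemma iterate_hpoint: "(G ^^ q) (chart_embed x) = hpoint (((*v) N ^^ q) (homog x))"
  unfolding G_eq chart_embed_homog by (rule funpow_projectivity_hpoint[OF N_inv homog_nonzero])

lemma affine_iterate:
  assumes "denom x q \<noteq> 0"
  shows "affine_point ((G ^^ q) (chart_embed x)) = X + (1 / denom x q) *\<^sub>R ((*v) M ^^ q) (x - X)"
proof -
  have 3: "((*v) N ^^ q) (homog x) $ 3 \<noteq> 0"
    using assms lam_nonzero by (simp add: third_funpow)
  then have "affine_point ((G ^^ q) (chart_embed x)) = X +
      (1 / (lam ^ q * denom x q)) *\<^sub>R (lam ^ q *\<^sub>R ((*v) M ^^ q) (x - X))"
    unfolding iterate_hpoint by (simp add: affine_point_hpoint dehomog_offset[where X = X] offset_funpow third_funpow)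
  then show ?thesis using lam_nonzero by simp
qed

text \<open>Convergence of \<open>denom\<close> would exclude zeros only for large \<open>q\<close>;
  a chart point as image excludes one at the given \<open>q\<close>.\<close>

lemma chart_iterate:
  assumes "chart_embed y = (G ^^ q) (chart_embed x)"
  shows "denom x q \<noteq> 0" and "y = X + (1 / denom x q) *\<^sub>R ((*v) M ^^ q) (x - X)"
proof -
  have "hpoint (homog y) = hpoint (((*v) N ^^ q) (homog x))"
    using assms by (simp only: iterate_hpoint chart_embed_homog[of y])
  then obtain k where k: "k \<noteq> 0" "((*v) N ^^ q) (homog x) = k *\<^sub>R homog y"
    by (rule hpoint_eqD) (simp_all add: N_inv funpow_matrix_nonzero)
  then have "lam ^ q * denom x q = k" by (simp flip: third_funpow)
  with k(1) show d: "denom x q \<noteq> 0" by auto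
  show "y = X + (1 / denom x q) *\<^sub>R ((*v) M ^^ q) (x - X)"
    unfolding affine_iterate[OF d, symmetric] assms[symmetric] by simp
qed

lemma invariant_form_exists: "\<exists>H. sym_posdef H \<and> transpose M ** H ** M = \<tau>\<^sup>2 *\<^sub>R H"
  using ex1_invariant_form[OF disc_M] unfolding det_M by blast

text \<open>The form is multiplied by exactly \<tau>^2 at each step, and coercivity turns this into
  a norm bound with a constant depending on \<open>p\<close>.\<close>

lemma M_decay:
  obtains B where "0 \<le> B" "\<And>q. norm (((*v) M ^^ q) p) \<le> B * \<tau> ^ q"
proof -
  obtain H where H: "sym_posdef H" "transpose M ** H ** M = \<tau>\<^sup>2 *\<^sub>R H"
    using invariant_form_exists by blast
  obtain c where c: "0 < c" "\<And>x. c * (norm x)\<^sup>2 \<le> x \<bullet> (H *v x)"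
    using sym_posdef_coercive[OF H(1)] by blast
  have p0: "0 \<le> p \<bullet> (H *v p)" using c(1) c(2)[of p] by (smt (verit) mult_nonneg_nonneg zero_le_power2)
  have "norm (((*v) M ^^ q) p) \<le> sqrt (p \<bullet> (H *v p) / c) * \<tau> ^ q" for q
  proof -
    have "c * (norm (((*v) M ^^ q) p))\<^sup>2 \<le> (\<tau>\<^sup>2) ^ q * (p \<bullet> (H *v p))"
      using c(2) unfolding invariant_form_funpow[OF H(2), symmetric] .
    then have "(norm (((*v) M ^^ q) p))\<^sup>2 \<le> (p \<bullet> (H *v p) / c) * (\<tau> ^ q)\<^sup>2"
      using c(1) by (simp add: field_simps power_mult[symmetric] mult.commute)
    also have "\<dots> = (sqrt (p \<bullet> (H *v p) / c) * \<tau> ^ q)\<^sup>2"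
      using p0 c(1) by (simp add: power_mult_distrib)
    finally show ?thesis
      by (rule power2_le_imp_le) (use p0 c(1) \<tau>_pos in simp)
  qed
  moreover have "0 \<le> sqrt (p \<bullet> (H *v p) / c)" using p0 c(1) by simp
  ultimately show ?thesis using that by blast
qed

lemma M_funpow_tendsto_0: "(\<lambda>q. ((*v) M ^^ q) p) \<longlonglongrightarrow> 0"
proof -
  obtain B where B: "\<And>q. norm (((*v) M ^^ q) p) \<le> B * \<tau> ^ q" using M_decay by blast
  have "(\<lambda>q. \<tau> ^ q) \<longlonglongrightarrow> 0"
    using less_imp_le[OF \<tau>_pos] \<tau>_less_1 by (rule LIMSEQ_realpow_zero)
  then have "(\<lambda>q. B * \<tau> ^ q) \<longlonglongrightarrow> 0" by (rule tendsto_mult_right_zero)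
  with always_eventually show ?thesis by (rule Lim_null_comparison) (intro allI B)
qed

lemma denom_tendsto: "denom x \<longlonglongrightarrow> ell (homog x)"
proof -
  have "(\<lambda>q. ell (homog x) - kvec \<bullet> ((*v) M ^^ q) (x - X)) \<longlonglongrightarrow> ell (homog x) - kvec \<bullet> 0"
    by (intro tendsto_intros M_funpow_tendsto_0)
  then show ?thesis unfolding denom_def[abs_def] by simp
qed

lemma scaled_funpow: "\<tau> ^ q *\<^sub>R (((\<lambda>u. ((1 / \<tau>) *\<^sub>R M) *v u) ^^ q) p) = ((*v) M ^^ q) p"
proof (induction q)
  case (Suc q)
  have "\<tau> ^ Suc q *\<^sub>R (((\<lambda>u. ((1 / \<tau>) *\<^sub>R M) *v u) ^^ Suc q) p) =
      M *v (\<tau> ^ q *\<^sub>R (((\<lambda>u. ((1 / \<tau>) *\<^sub>R M) *v u) ^^ q) p))"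
    using \<tau>_pos by (simp add: matrix_vector_mult_scaleR flip: scaleR_matrix_vector_assoc)
  then show ?case by (simp add: Suc.IH)
qed simp

text \<open>The reciprocals of \<open>denom x q\<close> and of its limit differ by a multiple of
  \<open>kvec \<bullet> M\<^sup>q (x - X)\<close>, of order \<open>\<tau>\<^sup>q\<close>, and this
  difference multiplies a vector of order \<open>\<tau>\<^sup>q\<close>; hence the exponent
  2q.\<close>

lemma leading_coeff_bigo:
  assumes "ell (homog x) \<noteq> 0"
  shows "(\<lambda>q. norm (affine_point ((G ^^ q) (chart_embed x)) - (X + ((*v) M ^^ q) ((1 / ell (homog x)) *\<^sub>R (x - X)))))
    \<in> O(\<lambda>q. \<tau> ^ (2 * q))"
proof -
  let ?l = "ell (homog x)"
  obtain B where B: "0 \<le> B" "\<And>q. norm (((*v) M ^^ q) (x - X)) \<le> B * \<tau> ^ q" using M_decay by blast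
  have "\<forall>\<^sub>F q in sequentially. \<bar>?l\<bar> / 2 < \<bar>denom x q\<bar>"
    using assms by (intro order_tendstoD(1)[OF tendsto_rabs[OF denom_tendsto]]) auto
  then have "\<forall>\<^sub>F q in sequentially. norm (norm (affine_point ((G ^^ q) (chart_embed x)) - (X + ((*v) M ^^ q) ((1 / ?l) *\<^sub>R (x - X)))))
     \<le> (norm kvec * B * B / (\<bar>?l\<bar> / 2 * \<bar>?l\<bar>)) * norm (\<tau> ^ (2 * q))"
  proof eventually_elim
    case (elim q)
    then have d: "denom x q \<noteq> 0" using assms by auto
    have "affine_point ((G ^^ q) (chart_embed x)) - (X + ((*v) M ^^ q) ((1 / ?l) *\<^sub>R (x - X)))
      = (1 / denom x q - 1 / ?l) *\<^sub>R ((*v) M ^^ q) (x - X)"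
      unfolding affine_iterate[OF d] linear_scale[OF linear_funpow_matrix] by (simp add: scaleR_left_diff_distrib)
    also have "1 / denom x q - 1 / ?l = (kvec \<bullet> ((*v) M ^^ q) (x - X)) / (denom x q * ?l)"
      using d assms by (simp add: denom_def field_simps)
    finally have "norm (affine_point ((G ^^ q) (chart_embed x)) - (X + ((*v) M ^^ q) ((1 / ?l) *\<^sub>R (x - X))))
      = \<bar>kvec \<bullet> ((*v) M ^^ q) (x - X)\<bar> * norm (((*v) M ^^ q) (x - X)) / (\<bar>denom x q\<bar> * \<bar>?l\<bar>)"
      by (simp add: abs_mult)
    also have "\<dots> \<le> (norm kvec * (B * \<tau> ^ q)) * (B * \<tau> ^ q) / (\<bar>?l\<bar> / 2 * \<bar>?l\<bar>)"
    proof (rule frac_le)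
      have "\<bar>kvec \<bullet> ((*v) M ^^ q) (x - X)\<bar> \<le> norm kvec * norm (((*v) M ^^ q) (x - X))"
        by (rule Cauchy_Schwarz_ineq2)
      also have "\<dots> \<le> norm kvec * (B * \<tau> ^ q)" by (intro mult_left_mono B) simp
      finally show "\<bar>kvec \<bullet> ((*v) M ^^ q) (x - X)\<bar> * norm (((*v) M ^^ q) (x - X)) \<le> (norm kvec * (B * \<tau> ^ q)) * (B * \<tau> ^ q)"
        using B \<tau>_pos by (intro mult_mono) auto
      show "0 < \<bar>?l\<bar> / 2 * \<bar>?l\<bar>" using assms by (intro mult_pos_pos) auto
      show "\<bar>?l\<bar> / 2 * \<bar>?l\<bar> \<le> \<bar>denom x q\<bar> * \<bar>?l\<bar>" using elim by (intro mult_right_mono) auto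
      show "0 \<le> (norm kvec * (B * \<tau> ^ q)) * (B * \<tau> ^ q)" using B \<tau>_pos by simp
    qed
    also have "\<dots> = (norm kvec * B * B / (\<bar>?l\<bar> / 2 * \<bar>?l\<bar>)) * norm (\<tau> ^ (2 * q))"
    proof -
      have "norm (\<tau> ^ (2 * q)) = \<tau> ^ q * \<tau> ^ q" using \<tau>_pos by (simp add: mult_2 power_add)
      then show ?thesis unfolding \<open>norm (\<tau> ^ (2 * q)) = \<tau> ^ q * \<tau> ^ q\<close>
        by (simp only: times_divide_eq_left times_divide_eq_right mult_ac)
    qed
    finally show ?case unfolding real_norm_def abs_norm_cancel .
  qed
  then show ?thesis by (rule bigoI)
qed

lemma leading_coeff_eq:
  assumes "ell (homog x) \<noteq> 0"
  shows "leading_coeff G X \<tau> x = (1 / ell (homog x)) *\<^sub>R (x - X)"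
  unfolding leading_coeff_def Let_def scaled_funpow
proof (rule the_equality)
  let ?f = "\<lambda>q. affine_point ((G ^^ q) (chart_embed x))"
  let ?\<xi> = "(1 / ell (homog x)) *\<^sub>R (x - X)"
  show O1: "(\<lambda>q. norm (?f q - (X + ((*v) M ^^ q) ?\<xi>))) \<in> O(\<lambda>q. \<tau> ^ (2 * q))"
    by (rule leading_coeff_bigo[OF assms])
  fix \<xi> assume O2: "(\<lambda>q. norm (?f q - (X + ((*v) M ^^ q) \<xi>))) \<in> O(\<lambda>q. \<tau> ^ (2 * q))"
  \<comment> \<open>Two candidates give \<open>M\<^sup>q p = O(\<tau>\<^sup>2\<^sup>q)\<close>, so
    the form at \<open>M\<^sup>q p\<close> is \<open>O(\<tau>\<^sup>4\<^sup>q)\<close>. It equals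
    \<open>\<tau>\<^sup>2\<^sup>q\<close> times the form at \<open>p\<close>, which therefore
    vanishes in the limit.\<close>
  define p where "p = \<xi> - ?\<xi>"
  obtain C where C: "\<forall>\<^sub>F q in sequentially. norm (norm (?f q - (X + ((*v) M ^^ q) ?\<xi>)) + norm (?f q - (X + ((*v) M ^^ q) \<xi>)))
      \<le> C * norm (\<tau> ^ (2 * q))"
    using landau_o.bigE[OF sum_in_bigo(1)[OF O1 O2]] by blast
  obtain H where H: "sym_posdef H" "transpose M ** H ** M = \<tau>\<^sup>2 *\<^sub>R H"
    using invariant_form_exists by blast
  obtain K where K: "0 \<le> K" "\<And>y. norm (H *v y) \<le> norm y * K"
    using bounded_linear.nonneg_bounded[OF matrix_vector_mul_bounded_linear, of H] by blast
  have "\<forall>\<^sub>F q in sequentially. p \<bullet> (H *v p) \<le> K * C\<^sup>2 * (\<tau>\<^sup>2) ^ q"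
    using C
  proof eventually_elim
    case (elim q)
    let ?y = "((*v) M ^^ q) p"
    have "?y = (?f q - (X + ((*v) M ^^ q) ?\<xi>)) - (?f q - (X + ((*v) M ^^ q) \<xi>))"
      by (simp add: p_def linear_diff[OF linear_funpow_matrix])
    then have "norm ?y \<le> norm (?f q - (X + ((*v) M ^^ q) ?\<xi>)) + norm (?f q - (X + ((*v) M ^^ q) \<xi>))"
      by (metis norm_triangle_ineq4)
    then have y: "norm ?y \<le> C * \<tau> ^ (2 * q)" using elim \<tau>_pos by simp
    have "(\<tau>\<^sup>2) ^ q * (p \<bullet> (H *v p)) = ?y \<bullet> (H *v ?y)"
      by (simp only: invariant_form_funpow[OF H(2)])
    also have "\<dots> \<le> norm ?y * (norm ?y * K)"
      by (rule order_trans[OF norm_cauchy_schwarz mult_left_mono[OF K(2)]]) simp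
    also have "\<dots> \<le> (C * \<tau> ^ (2 * q)) * ((C * \<tau> ^ (2 * q)) * K)"
      using y K(1) by (intro mult_mono) (auto intro: order_trans[OF norm_ge_zero])
    also have "\<dots> = (\<tau>\<^sup>2) ^ q * (K * C\<^sup>2 * (\<tau>\<^sup>2) ^ q)"
      by (simp add: power_mult power2_eq_square)
    finally show ?case using \<tau>_pos by simp
  qed
  moreover have "(\<lambda>q. K * C\<^sup>2 * (\<tau>\<^sup>2) ^ q) \<longlonglongrightarrow> K * C\<^sup>2 * 0"
    using \<tau>_pos \<tau>_less_1 by (intro tendsto_mult_left LIMSEQ_realpow_zero) (auto simp: power_less_one_iff)
  ultimately have "p \<bullet> (H *v p) \<le> 0"
    by (intro tendsto_lowerbound[where F = sequentially]) auto
  then have "p = 0" using H(1) unfolding sym_posdef_def by (metis not_le)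
  then show "\<xi> = ?\<xi>" by (simp add: p_def)
qed

text \<open>A second fixed point \<open>y\<close> in the chart would make \<open>y - X\<close> a
  real eigenvector of \<open>M\<close>, against the negative discriminant.\<close>

lemma fixed_point_unique:
  assumes "G (chart_embed y) = chart_embed y"
  shows "y = X"
proof (rule ccontr)
  assume "y \<noteq> X"
  define p where "p = y - X"
  have p: "p \<noteq> 0" using \<open>y \<noteq> X\<close> by (simp add: p_def)
  have "hpoint (homog y) = hpoint (N *v homog y)"
    using assms unfolding G_eq chart_embed_homog projectivity_hpoint[OF homog_nonzero] by (rule sym)
  then obtain k where "N *v homog y = k *\<^sub>R homog y"
    by (rule hpoint_eqD) (simp_all add: N_inv invertible_mult_nonzero)
  then have "lam *\<^sub>R (M *v p) = k *\<^sub>R p"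
    unfolding p_def offset_homog[symmetric] offset_N[symmetric] by (simp add: linear_scale[OF linear_offset])
  then have "(1 / lam) *\<^sub>R (lam *\<^sub>R (M *v p)) = (1 / lam) *\<^sub>R (k *\<^sub>R p)" by (rule arg_cong)
  then have Mp: "M *v p = (k / lam) *\<^sub>R p" using lam_nonzero by simp
  define e where "e = k / lam"
  have "(e\<^sup>2 - trace M * e + det M) *\<^sub>R p = 0"
    using cayley_hamilton_M[of p] unfolding Mp matrix_vector_mult_scaleR e_def[symmetric]
    by (simp add: algebra_simps power2_eq_square)
  then have e0: "e\<^sup>2 - trace M * e + det M = 0" using p by simp
  have "(2 * e - trace M)\<^sup>2 = 4 * (e\<^sup>2 - trace M * e + det M) + ((trace M)\<^sup>2 - 4 * det M)"
    by (simp add: power2_eq_square algebra_simps)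
  then have "0 \<le> (trace M)\<^sup>2 - 4 * det M"
    using zero_le_power2[of "2 * e - trace M"] unfolding e0 by simp
  then show False using disc_M by simp
qed

lemma G_fixes_X: "G (chart_embed X) = chart_embed X"
  unfolding G_eq chart_embed_homog projectivity_hpoint[OF homog_nonzero] N_homog_X
  by (simp add: hpoint_scaleR lam_nonzero)

lemma cross2_funpow: "cross2 (((*v) M ^^ q) x) (((*v) M ^^ q) y) = (\<tau>\<^sup>2) ^ q * cross2 x y"
  by (induction q) (simp_all add: cross2_matrix det_M)

end

subsection \<open>The normalized orbit\<close>

locale elliptic_orbit = elliptic_projectivity +
  fixes n m :: nat and s :: int and P :: "int \<Rightarrow> real^2"
  assumes ret: "return_relation n P m s G"
    and nondeg: "nondegenerate_orbit n P m G N \<rho> \<theta> v X \<tau>"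
begin

lemma ngon_P: "ngon n P" and n_pos: "1 \<le> n"
  and dfd: "pentagram_defined ((pentagram ^^ k) P)" and area_nz: "area n ((pentagram ^^ k) P) \<noteq> 0"
  using ret by (simp_all add: return_relation_def ngon_def[of n P])

lemma area_P: "0 < area n P"
  using area_nz[of 0] unfolding area_def by simp

lemma ell_nonzero:
  assumes "r < m"
  shows "ell (homog ((pentagram ^^ r) P i)) \<noteq> 0"
  using nondeg[unfolded nondegenerate_orbit_def, THEN conjunct1, rule_format, OF assms,
      of "homog ((pentagram ^^ r) P i)" i]
  by (intro projection_nonzero_imp) (simp add: chart_embed_homog)

definition xi :: "nat \<Rightarrow> int \<Rightarrow> real^2" where
  "xi r i = leading_coeff G X \<tau> ((pentagram ^^ r) P i)"

abbreviation w :: "nat \<Rightarrow> int \<Rightarrow> real^2" where "w \<equiv> limit_shape n G X \<tau> P"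

lemma w_eq: "w r = (\<lambda>i. xi r i - centroid n (xi r))"
  by (simp add: limit_shape_def xi_def[abs_def])

text \<open>Up to relabelling, the vertices of \<open>T\<^sup>q\<^sup>m\<^sup>+\<^sup>r(P)\<close> pulled back by \<open>x \<mapsto> X + M\<^sup>q x\<close>.\<close>

definition pullback :: "nat \<Rightarrow> nat \<Rightarrow> int \<Rightarrow> real^2" where
  "pullback q r i = (1 / denom ((pentagram ^^ r) P i) q) *\<^sub>R ((pentagram ^^ r) P i - X)"

lemma pullback_tendsto:
  assumes "r < m"
  shows "(\<lambda>q. pullback q r i) \<longlonglongrightarrow> xi r i"
  unfolding pullback_def xi_def leading_coeff_eq[OF ell_nonzero[OF assms]]
  by (intro tendsto_intros denom_tendsto ell_nonzero[OF assms])

lemma ngon_iterate: "ngon n ((pentagram ^^ k) P)"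
  by (rule ngon_funpow_pentagram[OF ngon_P])

lemma ngon_pullback: "ngon n (pullback q r)"
  using ngon_iterate[of r] by (simp add: ngon_def pullback_def)

lemma ngon_xi: "ngon n (xi r)"
  using ngon_iterate[of r] by (simp add: ngon_def xi_def)

lemma iterate_eq: "(pentagram ^^ (q * m + r)) P i = X + ((*v) M ^^ q) (pullback q r (i + int q * s))"
  using chart_iterate(2)[OF return_relation_iterate[OF ret[unfolded G_eq] N_inv, folded G_eq]]
  by (simp add: pullback_def linear_scale[OF linear_funpow_matrix])

lemma area_iterate: "area n ((pentagram ^^ (q * m + r)) P) = (\<tau>\<^sup>2) ^ q * area n (pullback q r)"
proof -
  \<comment> \<open>The polygon with the shift by q s undone; area is invariant under that
    shift.\<close>
  define Y where "Y i = X + ((*v) M ^^ q) (pullback q r i)" for i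
  have "(pentagram ^^ (q * m + r)) P = (\<lambda>i. Y (i + int q * s))"
    by (rule ext) (simp only: iterate_eq Y_def)
  moreover have "ngon n Y" using ngon_pullback[of q r] by (simp add: ngon_def Y_def)
  ultimately have "area n ((pentagram ^^ (q * m + r)) P) = area n Y" by (simp only: area_shift)
  also have "\<dots> = \<bar>(\<tau>\<^sup>2) ^ q\<bar> * area n (pullback q r)"
    unfolding Y_def[abs_def] by (rule area_linear[OF ngon_pullback linear_funpow_matrix cross2_funpow])
  finally show ?thesis by simp
qed

lemma centroid_iterate: "centroid n ((pentagram ^^ (q * m + r)) P) = X + ((*v) M ^^ q) (centroid n (pullback q r))"
proof -
  define Y where "Y i = X + ((*v) M ^^ q) (pullback q r i)" for i
  have "(pentagram ^^ (q * m + r)) P = (\<lambda>i. Y (i + int q * s))"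
    by (rule ext) (simp only: iterate_eq Y_def)
  moreover have "ngon n Y" using ngon_pullback[of q r] by (simp add: ngon_def Y_def)
  ultimately have "centroid n ((pentagram ^^ (q * m + r)) P) = centroid n Y" by (simp only: centroid_shift)
  also have "\<dots> = X + ((*v) M ^^ q) (centroid n (pullback q r))"
    unfolding Y_def[abs_def] by (rule centroid_linear[OF n_pos linear_funpow_matrix])
  finally show ?thesis .
qed

definition relabelled :: "nat \<Rightarrow> nat \<Rightarrow> int \<Rightarrow> real^2" where
  "relabelled q r = relabel (- (int q * s)) ((normalized_pentagram n ^^ (q * m + r)) P)"

lemmas normalized_eq = funpow_normalized_pentagram[OF ngon_P dfd area_nz]

lemma relabelled_eq: "relabelled q r i - centroid n P =
    sqrt (area n P / ((\<tau>\<^sup>2) ^ q * area n (pullback q r))) *\<^sub>R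
      ((*v) M ^^ q) (pullback q r i - centroid n (pullback q r))"
  unfolding relabelled_def relabel_def normalized_eq area_iterate centroid_iterate iterate_eq
  by (simp add: linear_diff[OF linear_funpow_matrix])

text \<open>Exact for every \<open>q\<close>, so the asymptotics reduce to the convergence of
  \<open>pullback\<close>.\<close>

lemma form_relabelled:
  assumes H: "transpose M ** H ** M = \<tau>\<^sup>2 *\<^sub>R H"
  shows "(relabelled q r i - centroid n P) \<bullet> (H *v (relabelled q r i - centroid n P)) =
    area n P / area n (pullback q r) *
      ((pullback q r i - centroid n (pullback q r)) \<bullet> (H *v (pullback q r i - centroid n (pullback q r))))"
proof -
  have "0 \<le> area n Q" for Q by (simp add: area_def)
  then have "(sqrt (area n P / ((\<tau>\<^sup>2) ^ q * area n (pullback q r))))\<^sup>2 = area n P / ((\<tau>\<^sup>2) ^ q * area n (pullback q r))"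
    by simp
  then show ?thesis
    unfolding relabelled_eq quadratic_form_scaleR invariant_form_funpow[OF H] using \<tau>_pos by simp
qed

lemma area_w: "area n (w r) = area n (xi r)"
  using area_homothety[OF ngon_xi, of "- centroid n (xi r)" 1 r] by (simp add: w_eq)

lemma w_nonzero: "r < m \<Longrightarrow> w r i \<noteq> 0" and area_w_pos: "r < m \<Longrightarrow> 0 < area n (w r)"
  using nondeg unfolding nondegenerate_orbit_def by blast+

lemma form_relabelled_tendsto:
  assumes H: "transpose M ** H ** M = \<tau>\<^sup>2 *\<^sub>R H" and r: "r < m"
  shows "(\<lambda>q. (relabelled q r i - centroid n P) \<bullet> (H *v (relabelled q r i - centroid n P)))
    \<longlonglongrightarrow> level n G X \<tau> P H r i"
proof -
  have area: "(\<lambda>q. area n (pullback q r)) \<longlonglongrightarrow> area n (w r)"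
    unfolding area_w unfolding area_cross2 cross2_def by (intro tendsto_intros pullback_tendsto r)
  have diff: "(\<lambda>q. pullback q r i - centroid n (pullback q r)) \<longlonglongrightarrow> w r i"
    unfolding w_eq centroid_def by (intro tendsto_intros pullback_tendsto r)
  have "area n (w r) \<noteq> 0" using area_w_pos[OF r] by simp
  moreover have "(\<lambda>q. H *v (pullback q r i - centroid n (pullback q r))) \<longlonglongrightarrow> H *v w r i"
    by (rule bounded_linear.tendsto[OF matrix_vector_mul_bounded_linear diff])
  ultimately show ?thesis
    unfolding form_relabelled[OF H] level_def Let_def by (intro tendsto_intros area diff)
qed

lemma level_pos:
  assumes "sym_posdef H" "r < m"
  shows "0 < level n G X \<tau> P H r i"
  using assms area_P area_w_pos w_nonzero by (simp add: level_def Let_def sym_posdef_def)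

text \<open>Relabelling only permutes one period. \<open>F\<close> is arbitrary so as to cover both
  the vertices and the values of the form at them.\<close>

lemma relabelled_image:
  "(\<lambda>i. F (relabelled q r i)) ` {1..int n} = (\<lambda>i. F ((normalized_pentagram n ^^ (q * m + r)) P i)) ` {1..int n}"
  unfolding relabelled_def relabel_def
  by (rule periodic_image_shift[of "\<lambda>i. F ((normalized_pentagram n ^^ (q * m + r)) P i)", OF _ n_pos])
    (use ngon_iterate[of "q * m + r"] in \<open>simp add: normalized_eq ngon_def\<close>)

end

lemma elliptic_setting_iff:
  "elliptic_setting n P m s G N lam \<rho> \<theta> v X \<tau> \<phi> \<longleftrightarrow> elliptic_orbit G N lam \<rho> \<theta> v X \<tau> \<phi> n m s P"
  unfolding elliptic_setting_def elliptic_orbit_def elliptic_orbit_axioms_def elliptic_projectivity_def by blast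

text \<open>The two settings share only \<open>G\<close>: \<open>X\<close> is its unique fixed point
  in the chart, and \<tau>^2 is the determinant of the linearization there.\<close>

lemma same_projectivity:
  assumes "elliptic_projectivity G N lam \<rho> \<theta> v X \<tau> \<phi>" "elliptic_projectivity G N' lam' \<rho>' \<theta>' v' X' \<tau>' \<phi>'"
  shows "X' = X" "\<tau>' = \<tau>"
proof -
  interpret A: elliptic_projectivity G N lam \<rho> \<theta> v X \<tau> \<phi> by fact
  interpret B: elliptic_projectivity G N' lam' \<rho>' \<theta>' v' X' \<tau>' \<phi>' by fact
  show X: "X' = X" by (rule A.fixed_point_unique[OF B.G_fixes_X])
  have "\<tau>'\<^sup>2 = \<tau>\<^sup>2" using A.det_M B.det_M unfolding X by simp
  then show "\<tau>' = \<tau>" using A.\<tau>_pos B.\<tau>_pos by (simp add: power2_eq_iff_nonneg)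
qed

text \<open>Dependence on \<open>G\<close> alone is expressed by comparison: a second setting with
  the same \<open>G\<close>, but possibly another polygon, matrix, period or shift, must give
  ellipses with the same principal directions and axis ratio.\<close>

theorem proposition6p4:
  fixes n m :: nat and s :: int
    and P :: "int \<Rightarrow> real^2" and G :: "rp2 \<Rightarrow> rp2" and N :: "real^3^3"
    and lam\<^sub>1 \<rho> \<theta> \<tau> \<phi> :: real and v\<^sub>1 :: "real^3" and X\<^sub>1 :: "real^2"
    and A :: "real^2^2" and b c :: "real^2" and d :: real
    and M :: "real^2^2" and C\<^sub>0 :: "real^2"
    and S :: "real^2^2 \<Rightarrow> nat \<Rightarrow> int \<Rightarrow> real"
    and E :: "real^2^2 \<Rightarrow> nat \<Rightarrow> int \<Rightarrow> (real^2) set"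
    and Pn Pt :: "nat \<Rightarrow> nat \<Rightarrow> int \<Rightarrow> real^2"
    and adapted :: "real^2^2 \<Rightarrow> bool"
  assumes setting: "elliptic_setting n P m s G N lam\<^sub>1 \<rho> \<theta> v\<^sub>1 X\<^sub>1 \<tau> \<phi>"
    and chart: "\<And>x. G (chart_embed x) \<in> range chart_embed \<Longrightarrow>
        c \<bullet> x + d \<noteq> 0 \<and> affine_map G x = (1 / (c \<bullet> x + d)) *\<^sub>R (A *v x + b)"
    and M: "M = linearization G X\<^sub>1"
    and C\<^sub>0: "C\<^sub>0 = centroid n P"
    and adapted: "\<And>H. adapted H \<longleftrightarrow> sym_posdef H \<and> transpose M ** H ** M = \<tau>\<^sup>2 *\<^sub>R H"
    and S: "S = level n G X\<^sub>1 \<tau> P"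
    and E: "E = (\<lambda>H r i. ellipse C\<^sub>0 H (S H r i))"
    and Pn: "Pn = (\<lambda>q r. (normalized_pentagram n ^^ (q * m + r)) P)"
    and Pt: "Pt = (\<lambda>q r. relabel (- (int q * s)) (Pn q r))"
  shows
    \<comment> \<open>the linearization and its eigenvalues\<close>
    "(affine_map G has_derivative (\<lambda>h. M *v h)) (at X\<^sub>1) \<and>
     M = (1 / (c \<bullet> X\<^sub>1 + d)) *\<^sub>R (A - (\<chi> i j. X\<^sub>1 $ i * c $ j)) \<and>
     eigenvalues M = {\<tau> * cis \<phi>, \<tau> * cis (- \<phi>)} \<and>
     \<comment> \<open>existence and uniqueness of the quadratic form up to scale\<close>
     (\<exists>H. adapted H \<and> (\<forall>H'. adapted H' \<longleftrightarrow> (\<exists>k>0. H' = k *\<^sub>R H))) \<and>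
     (\<forall>H. adapted H \<longrightarrow>
       \<comment> \<open>asymptotic ellipses\<close>
       (\<forall>r<m. \<forall>i.
          0 < S H r i \<and>
          (\<lambda>q. (Pt q r i - C\<^sub>0) \<bullet> (H *v (Pt q r i - C\<^sub>0))) \<longlonglongrightarrow> S H r i \<and>
          (\<lambda>q. infdist (Pt q r i) (E H r i)) \<longlonglongrightarrow> 0) \<and>
       \<comment> \<open>rescaling the quadratic form\<close>
       (\<forall>k>0. \<forall>r<m. \<forall>i. S (k *\<^sub>R H) r i = k * S H r i \<and> E (k *\<^sub>R H) r i = E H r i) \<and>
       \<comment> \<open>concentric and homothetic\<close>
       (\<forall>r<m. \<forall>r'<m. \<forall>i i'. homothetic_about C\<^sub>0 (E H r i) (E H r' i')) \<and>
       \<comment> \<open>principal directions and axis ratio depend on the projectivity only\<close>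
       (\<forall>n' P' m' s' N' lam\<^sub>1' \<rho>' \<theta>' v\<^sub>1' X\<^sub>1' \<tau>' \<phi>' H'.
          elliptic_setting n' P' m' s' G N' lam\<^sub>1' \<rho>' \<theta>' v\<^sub>1' X\<^sub>1' \<tau>' \<phi>' \<and> sym_posdef H' \<and>
          transpose (linearization G X\<^sub>1') ** H' ** linearization G X\<^sub>1' = \<tau>'\<^sup>2 *\<^sub>R H' \<longrightarrow>
          (\<forall>r<m. \<forall>r'<m'. \<forall>i i'.
             let E' = ellipse (centroid n' P') H' (level n' G X\<^sub>1' \<tau>' P' H' r' i')
             in principal_directions (centroid n' P') E' = principal_directions C\<^sub>0 (E H r i) \<and>
                axis_ratio (centroid n' P') E' = axis_ratio C\<^sub>0 (E H r i))) \<and>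
       \<comment> \<open>setwise version without undoing the relabelling\<close>
       (\<forall>r<m.
          setwise_tendsto
            (\<lambda>q. (\<lambda>j. (Pn q r j - C\<^sub>0) \<bullet> (H *v (Pn q r j - C\<^sub>0))) ` {1..int n})
            (S H r ` {1..int n}) \<and>
          (\<forall>\<epsilon>>0. \<forall>\<^sub>F q in sequentially.
             (\<forall>j\<in>{1..int n}. \<exists>i\<in>{1..int n}. infdist (Pn q r j) (E H r i) < \<epsilon>) \<and>
             (\<forall>i\<in>{1..int n}. \<exists>j\<in>{1..int n}. infdist (Pn q r j) (E H r i) < \<epsilon>))))"
proof -
  interpret orb: elliptic_orbit G N lam\<^sub>1 \<rho> \<theta> v\<^sub>1 X\<^sub>1 \<tau> \<phi> n m s P
    using setting by (simp only: elliptic_setting_iff)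
  have Pt_eq: "Pt q r i = orb.relabelled q r i" for q r i
    by (simp only: Pt Pn orb.relabelled_def)
  have M_eq: "M = (1 / (c \<bullet> X\<^sub>1 + d)) *\<^sub>R (A - (\<chi> i j. X\<^sub>1 $ i * c $ j))"
    unfolding M by (rule orb.linearization_eq[OF chart])
  have deriv: "(affine_map G has_derivative (\<lambda>h. M *v h)) (at X\<^sub>1)"
    unfolding M_eq by (rule orb.fractional_has_derivative[OF chart])
  have eig: "eigenvalues M = {\<tau> * cis \<phi>, \<tau> * cis (- \<phi>)}"
    unfolding M orb.eigenvalues_M by (simp add: orb.\<mu>_def cis_cnj)
  have form: "\<exists>H. adapted H \<and> (\<forall>H'. adapted H' \<longleftrightarrow> (\<exists>k>0. H' = k *\<^sub>R H))"
    using ex1_invariant_form[OF orb.disc_M] unfolding adapted M orb.det_M .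
  have adapted_ratio: "\<exists>k>0. H' = k *\<^sub>R H" if "adapted H" "adapted H'" for H H'
  proof -
    obtain K where K: "\<And>H'. adapted H' \<longleftrightarrow> (\<exists>k>0. H' = k *\<^sub>R K)" using form by blast
    from that obtain k k' where "k > 0" "H = k *\<^sub>R K" "k' > 0" "H' = k' *\<^sub>R K" unfolding K by blast
    then show ?thesis by (intro exI[of _ "k' / k"]) simp
  qed
  have S_pos: "0 < S H r i" if "adapted H" "r < m" for H r i
    unfolding S using that orb.level_pos by (simp add: adapted)
  have S_lim: "(\<lambda>q. (Pt q r i - C\<^sub>0) \<bullet> (H *v (Pt q r i - C\<^sub>0))) \<longlonglongrightarrow> S H r i"
    if "adapted H" "r < m" for H r i
    unfolding Pt_eq C\<^sub>0 S using that orb.form_relabelled_tendsto by (simp add: adapted M)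
  have E_lim: "(\<lambda>q. infdist (Pt q r i) (E H r i)) \<longlonglongrightarrow> 0" if "adapted H" "r < m" for H r i
    unfolding E using that S_pos[OF that] S_lim[OF that]
    by (intro infdist_ellipse_tendsto_0) (simp_all add: adapted)
  have S_scale: "S (k *\<^sub>R H) r i = k * S H r i" for k H r i
    by (simp add: S level_def Let_def flip: scaleR_matrix_vector_assoc)
  have E_scale: "E (k *\<^sub>R H) r i = E H r i" if "k > 0" for k H r i
    using that by (simp add: E S_scale ellipse_rescale)
  have homothetic: "homothetic_about C\<^sub>0 (E H r i) (E H r' i')" if "adapted H" "r < m" "r' < m" for H r r' i i'
    unfolding homothetic_about_def E
    using ellipse_homothety[OF S_pos[OF that(1,2)] S_pos[OF that(1,3)]] S_pos[OF that(1,2)] S_pos[OF that(1,3)]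
    by (intro exI[of _ "sqrt (S H r' i' / S H r i)"] conjI) (simp_all add: divide_pos_pos)
  have other: "let E' = ellipse (centroid n' P') H' (level n' G X\<^sub>1' \<tau>' P' H' r' i')
      in principal_directions (centroid n' P') E' = principal_directions C\<^sub>0 (E H r i) \<and>
        axis_ratio (centroid n' P') E' = axis_ratio C\<^sub>0 (E H r i)"
    if H: "adapted H" and r: "r < m" and r': "r' < m'"
      and set': "elliptic_setting n' P' m' s' G N' lam\<^sub>1' \<rho>' \<theta>' v\<^sub>1' X\<^sub>1' \<tau>' \<phi>'" and H': "sym_posdef H'"
      and inv': "transpose (linearization G X\<^sub>1') ** H' ** linearization G X\<^sub>1' = \<tau>'\<^sup>2 *\<^sub>R H'"
    for n' P' m' s' N' lam\<^sub>1' \<rho>' \<theta>' v\<^sub>1' X\<^sub>1' \<tau>' \<phi>' H' H r r' i i'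
  proof -
    interpret orb': elliptic_orbit G N' lam\<^sub>1' \<rho>' \<theta>' v\<^sub>1' X\<^sub>1' \<tau>' \<phi>' n' m' s' P'
      using set' by (simp only: elliptic_setting_iff)
    have X: "X\<^sub>1' = X\<^sub>1" and \<tau>: "\<tau>' = \<tau>"
      using same_projectivity[OF orb.elliptic_projectivity_axioms orb'.elliptic_projectivity_axioms] .
    have "adapted H'" using H' inv' by (simp add: adapted M X \<tau>)
    \<comment> \<open>Level \<open>t\<close> of \<open>H'\<close> is level \<open>t / k\<close> of
      \<open>H\<close>, so the other ellipse is a homothetic copy of \<open>E H r i\<close> about
      its own centre.\<close>
    then obtain k where k: "k > 0" "H' = k *\<^sub>R H" using adapted_ratio[OF H] by blast
    define t where "t = level n' G X\<^sub>1' \<tau>' P' H' r' i'"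
    have t: "0 < t / k" unfolding t_def using orb'.level_pos[OF H' r'] k(1) by simp
    let ?e = "sqrt ((t / k) / S H r i)"
    have "ellipse (centroid n' P') H' t = ellipse (centroid n' P') H (t / k)"
      unfolding k(2) using ellipse_rescale[of k "centroid n' P'" H "t / k"] k(1) by simp
    also have "\<dots> = (\<lambda>y. centroid n' P' + ?e *\<^sub>R (y - C\<^sub>0)) ` E H r i"
      unfolding E by (rule ellipse_homothety[OF S_pos[OF H r] t])
    finally have E': "ellipse (centroid n' P') H' t = (\<lambda>y. centroid n' P' + ?e *\<^sub>R (y - C\<^sub>0)) ` E H r i" .
    have e: "0 < ?e" unfolding real_sqrt_gt_0_iff by (rule divide_pos_pos[OF t S_pos[OF H r]])
    have "sym_posdef H" using H by (simp add: adapted)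
    note ne = ellipse_nonempty_bounded[OF this S_pos[OF H r], of C\<^sub>0]
    show ?thesis
      unfolding Let_def t_def[symmetric] E' principal_directions_homothety[OF e]
      using axis_ratio_homothety[OF e, of "E H r i" C\<^sub>0] ne by (simp add: E)
  qed
  have image: "(\<lambda>i. F (Pt q r i)) ` {1..int n} = (\<lambda>i. F (Pn q r i)) ` {1..int n}" for F :: "real^2 \<Rightarrow> 'b" and q r
    unfolding Pt_eq Pn by (rule orb.relabelled_image)
  have setwise: "setwise_tendsto (\<lambda>q. (\<lambda>j. (Pn q r j - C\<^sub>0) \<bullet> (H *v (Pn q r j - C\<^sub>0))) ` {1..int n}) (S H r ` {1..int n})"
    if "adapted H" "r < m" for H r
    using setwise_tendsto_finite_image[of "{1..int n}" "\<lambda>q i. (Pt q r i - C\<^sub>0) \<bullet> (H *v (Pt q r i - C\<^sub>0))" "S H r"]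
      S_lim[OF that] image[of "\<lambda>y. (y - C\<^sub>0) \<bullet> (H *v (y - C\<^sub>0))"] by simp
  have near: "\<forall>\<^sub>F q in sequentially.
      (\<forall>j\<in>{1..int n}. \<exists>i\<in>{1..int n}. infdist (Pn q r j) (E H r i) < \<epsilon>) \<and>
      (\<forall>i\<in>{1..int n}. \<exists>j\<in>{1..int n}. infdist (Pn q r j) (E H r i) < \<epsilon>)"
    if "adapted H" "r < m" "\<epsilon> > 0" for H r \<epsilon>
  proof -
    \<comment> \<open>Finitely many vertices allow one threshold for all; periodicity then matches
      the vertices of \<open>Pn q r\<close> and \<open>Pt q r\<close> in both directions.\<close>
    have "\<forall>\<^sub>F q in sequentially. \<forall>i\<in>{1..int n}. infdist (Pt q r i) (E H r i) < \<epsilon>"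
      using order_tendstoD(2)[OF E_lim[OF that(1,2)] that(3)] by (intro eventually_ball_finite) auto
    then show ?thesis
    proof eventually_elim
      case (elim q)
      have im: "Pt q r ` {1..int n} = Pn q r ` {1..int n}" using image[of "\<lambda>y. y" q r] by simp
      show ?case
      proof (intro conjI ballI)
        fix j assume "j \<in> {1..int n}"
        then have "Pn q r j \<in> Pt q r ` {1..int n}" unfolding im by (rule imageI)
        then obtain i where "i \<in> {1..int n}" "Pn q r j = Pt q r i" by blast
        with elim show "\<exists>i\<in>{1..int n}. infdist (Pn q r j) (E H r i) < \<epsilon>" by metis
      next
        fix i assume i: "i \<in> {1..int n}"
        then have "Pt q r i \<in> Pn q r ` {1..int n}" unfolding im[symmetric] by (rule imageI)
        then obtain j where "j \<in> {1..int n}" "Pt q r i = Pn q r j" by blast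
        with elim i show "\<exists>j\<in>{1..int n}. infdist (Pn q r j) (E H r i) < \<epsilon>" by metis
      qed
    qed
  qed
  show ?thesis
    by (intro conjI allI impI deriv M_eq eig form S_pos S_lim E_lim S_scale E_scale homothetic other
        setwise near; (elim conjE)?; assumption)
qed

end
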